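(* Let $n \geq 2$ be an integer. Then the decision problems $\mathrm{Pow}(n)$ and $\mathrm{EqSatCF}$ are polynomially equivalent, that is, $\mathrm{Pow}(n)\leq_p \mathrm{EqSatCF}$ and $\mathrm{EqSatCF}\leq_p\mathrm{Pow}(n)$.
   Context: Alphabets are finite and have at least two letters. Fix a target alphabet $\Gamma$ (the answers to the problems below do not depend on its choice). A morphism $h:\Sigma^*\to\Gamma^*$ is a map with $h(xy)=h(x)h(y)$ for all words $x,y$; it is periodic if there is a word $r$ with $h(x)\in r^*$ for all letters $x\in\Sigma$, and nonperiodic otherwise. A constant-free word equation over an alphabet $\Sigma$ (of variables) is a pair $(u,v)\in\Sigma^*\times\Sigma^*$; a solution of it is a morphism $h:\Sigma^*\to\Gamma^*$ with $h(u)=h(v)$. A system of equations is a set of equations, and a solution of a system is a morphism that is a solution of every equation in it. Decision problems: - $\mathrm{EqSatCF}$: given an alphabet $\Sigma$ and a finite system of constant-free word equations over $\Sigma$, decide whether the system has a nonperiodic solution. - $\mathrm{Pow}(n)$ (with $n$ fixed): given an alphabet $\Sigma$ and a word $w\in\Sigma^+$, decide whether there exist a nonperiodic morphism $h:\Sigma^*\to\Gamma^*$ and a nonempty word $r\in\Gamma^+$ with $h(w)=r^n$. $A\leq_p B$ means that $A$ is polynomial-time (many-one) reducible to $B$. *)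

theory Defs
  imports Complex_Main "HOL-Computational_Algebra.Polynomial"
begin

section \<open>Words, morphisms and word equations\<close>

definition alphabet :: "'a set \<Rightarrow> bool" where
  "alphabet A \<longleftrightarrow> finite A \<and> card A \<ge> 2"

definition word_pow :: "'a list \<Rightarrow> nat \<Rightarrow> 'a list" where
  "word_pow r k = concat (replicate k r)"

text \<open>The free monoid over an alphabet \<open>A\<close> is \<open>lists A\<close>; a morphism is a map on words, of which
  only the values on \<open>lists A\<close> matter.\<close>

definition morphism :: "'a set \<Rightarrow> 'c set \<Rightarrow> ('a list \<Rightarrow> 'c list) \<Rightarrow> bool" where
  "morphism A C h \<longleftrightarrow>
     (\<forall>x\<in>lists A. h x \<in> lists C) \<and>
     (\<forall>x\<in>lists A. \<forall>y\<in>lists A. h (x @ y) = h x @ h y)"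

definition periodic :: "'a set \<Rightarrow> 'c set \<Rightarrow> ('a list \<Rightarrow> 'c list) \<Rightarrow> bool" where
  "periodic A C h \<longleftrightarrow> (\<exists>r\<in>lists C. \<forall>x\<in>A. \<exists>k. h [x] = word_pow r k)"

type_synonym 'a equation = "'a list \<times> 'a list"

definition solution :: "'a set \<Rightarrow> 'c set \<Rightarrow> 'a equation set \<Rightarrow> ('a list \<Rightarrow> 'c list) \<Rightarrow> bool" where
  "solution A C E h \<longleftrightarrow> morphism A C h \<and> (\<forall>(u, v)\<in>E. h u = h v)"


section \<open>Multitape Turing machines\<close>

text \<open>A deterministic machine with \<open>tapes M\<close> two-way infinite tapes. The states are
  \<open>0, \<dots>, states M\<close>, where \<open>0\<close> is initial and \<open>states M\<close> is the unique halting state; the tape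
  symbols are \<open>0, \<dots>, symbols M - 1\<close>, where \<open>0\<close> is the blank and \<open>1\<close>, \<open>2\<close> stand for the bits.
  Well-formed machines have finite transition tables: only the arguments of \<open>delta M\<close> quantified
  over in \<open>wf_tm\<close> ever occur in a run.\<close>

datatype dir = Go_Left | Stay | Go_Right

record tm =
  tapes :: nat
  symbols :: nat
  states :: nat
  delta :: "nat \<Rightarrow> nat list \<Rightarrow> nat \<times> (nat \<times> dir) list"

definition wf_tm :: "tm \<Rightarrow> bool" where
  "wf_tm M \<longleftrightarrow> tapes M \<ge> 1 \<and> symbols M \<ge> 3 \<and>
     (\<forall>q < states M. \<forall>xs. length xs = tapes M \<and> set xs \<subseteq> {..<symbols M} \<longrightarrow>
        (case delta M q xs of (q', as) \<Rightarrow>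
           q' \<le> states M \<and> length as = tapes M \<and> fst ` set as \<subseteq> {..<symbols M}))"

type_synonym tape = "(int \<Rightarrow> nat) \<times> int"  \<comment> \<open>cell contents and head position\<close>
type_synonym config = "nat \<times> tape list"

fun read_tape :: "tape \<Rightarrow> nat" where
  "read_tape (t, p) = t p"

fun offset :: "dir \<Rightarrow> int" where
  "offset Go_Left = - 1"
| "offset Stay = 0"
| "offset Go_Right = 1"

fun act :: "nat \<times> dir \<Rightarrow> tape \<Rightarrow> tape" where
  "act (a, d) (t, p) = (t(p := a), p + offset d)"

fun step :: "tm \<Rightarrow> config \<Rightarrow> config" where
  "step M (q, ts) =
     (if q < states M
      then (case delta M q (map read_tape ts) of (q', as) \<Rightarrow> (q', map2 act as ts))
      else (q, ts))"

definition bit_symbol :: "bool \<Rightarrow> nat" where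
  "bit_symbol b = (if b then 2 else 1)"

definition input_tape :: "bool list \<Rightarrow> tape" where
  "input_tape x =
     ((\<lambda>i. if 0 \<le> i \<and> i < int (length x) then bit_symbol (x ! nat i) else 0), 0)"

definition init_config :: "tm \<Rightarrow> bool list \<Rightarrow> config" where
  "init_config M x = (0, input_tape x # replicate (tapes M - 1) (input_tape []))"

text \<open>The output is the bit string written on the last tape from cell \<open>0\<close> up to the first blank.\<close>

definition halts_with :: "tm \<Rightarrow> config \<Rightarrow> bool list \<Rightarrow> bool" where
  "halts_with M c y \<longleftrightarrow> fst c = states M \<and>
     (let t = fst (last (snd c)) in
        (\<forall>i < length y. t (int i) = bit_symbol (y ! i)) \<and> t (int (length y)) = 0)"


section \<open>Decision problems and polynomial-time reductions\<close>

text \<open>A decision problem consists of its instances, those instances with answer ``yes'', and an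
  encoding of instances as bit strings.\<close>

record 'a problem =
  instances :: "'a set"
  yes :: "'a set"
  encode :: "'a \<Rightarrow> bool list"

definition poly_time_computable ::
    "'a set \<Rightarrow> ('a \<Rightarrow> bool list) \<Rightarrow> ('b \<Rightarrow> bool list) \<Rightarrow> ('a \<Rightarrow> 'b) \<Rightarrow> bool" where
  "poly_time_computable X enc enc' f \<longleftrightarrow>
     (\<exists>M (p :: nat poly). wf_tm M \<and>
        (\<forall>x\<in>X. \<exists>t \<le> poly p (length (enc x)).
           halts_with M ((step M ^^ t) (init_config M (enc x))) (enc' (f x))))"

definition poly_reducible :: "'a problem \<Rightarrow> 'b problem \<Rightarrow> bool"  (infix "\<le>\<^sub>p" 50) where
  "A \<le>\<^sub>p B \<longleftrightarrow>
     (\<exists>f. poly_time_computable (instances A) (encode A) (encode B) f \<and>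
        (\<forall>x\<in>instances A. f x \<in> instances B \<and> (x \<in> yes A \<longleftrightarrow> f x \<in> yes B)))"


section \<open>Encoding of instances\<close>

text \<open>Prefix-free encodings. Numbers are written in unary. They are only used for the size of an
  alphabet and for letters of an alphabet \<open>{..<m}\<close> whose size \<open>m\<close> is part of the same instance, so,
  with an alphabet counted at its number of letters, this is polynomially related to writing
  letters in binary.\<close>

definition enc_nat :: "nat \<Rightarrow> bool list" where
  "enc_nat k = replicate k True @ [False]"

definition enc_pair :: "('a \<Rightarrow> bool list) \<Rightarrow> ('b \<Rightarrow> bool list) \<Rightarrow> 'a \<times> 'b \<Rightarrow> bool list" where
  "enc_pair e e' = (\<lambda>(x, y). e x @ e' y)"

definition enc_list :: "('a \<Rightarrow> bool list) \<Rightarrow> 'a list \<Rightarrow> bool list" where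
  "enc_list e xs = concat (map (\<lambda>x. True # e x) xs) @ [False]"

definition prefix_free :: "('a \<Rightarrow> bool list) \<Rightarrow> bool" where
  "prefix_free e \<longleftrightarrow> (\<forall>x y s t. e x @ s = e y @ t \<longrightarrow> x = y)"

lemma prefix_free_inj:
  assumes "prefix_free e"
  shows "inj e"
proof (rule injI)
  fix x y
  assume "e x = e y"
  then have "e x @ [] = e y @ []" by simp
  with assms show "x = y" unfolding prefix_free_def by blast
qed

lemma prefix_free_enc_nat: "prefix_free enc_nat"
proof -
  have *: "replicate x True @ False # s = replicate y True @ False # t \<Longrightarrow> x = y" for x y s t
  proof (induction x arbitrary: y)
    case 0
    then show ?case by (cases y) auto
  next
    case (Suc x)
    then show ?case by (cases y) auto
  qed
  have "x = y" if "enc_nat x @ s = enc_nat y @ t" for x y s t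
    by (rule *[of x s y t]) (use that in \<open>simp add: enc_nat_def\<close>)
  then show ?thesis unfolding prefix_free_def by blast
qed

lemma prefix_free_enc_pair:
  assumes "prefix_free e" and "prefix_free e'"
  shows "prefix_free (enc_pair e e')"
  unfolding prefix_free_def enc_pair_def
proof clarsimp
  fix a b c d s t
  assume *: "e a @ e' b @ s = e c @ e' d @ t"
  with assms(1) have "a = c" unfolding prefix_free_def by blast
  from * \<open>a = c\<close> have "e' b @ s = e' d @ t" by simp
  with assms(2) have "b = d" unfolding prefix_free_def by blast
  with \<open>a = c\<close> show "a = c \<and> b = d" by simp
qed

lemma prefix_free_enc_list:
  assumes "prefix_free e"
  shows "prefix_free (enc_list e)"
proof -
  have "enc_list e xs @ s = enc_list e ys @ t \<Longrightarrow> xs = ys" for xs ys s t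
  proof (induction xs arbitrary: ys)
    case Nil
    then show ?case by (cases ys) (auto simp: enc_list_def)
  next
    case (Cons x xs)
    show ?case
    proof (cases ys)
      case Nil
      with Cons.prems show ?thesis by (auto simp: enc_list_def)
    next
      case ys: (Cons y ys')
      from Cons.prems have *: "e x @ enc_list e xs @ s = e y @ enc_list e ys' @ t"
        by (simp add: ys enc_list_def)
      with assms have "x = y" unfolding prefix_free_def by blast
      with * Cons.IH show ?thesis by (simp add: ys)
    qed
  qed
  then show ?thesis unfolding prefix_free_def by blast
qed


section \<open>The two problems\<close>

text \<open>In instances, an alphabet with \<open>m\<close> letters is taken to be \<open>{..<m}\<close>, and a finite system of
  equations is given by a list of its members. The parameter \<open>C\<close> is the target alphabet.\<close>

definition Pow_problem :: "'c set \<Rightarrow> nat \<Rightarrow> (nat \<times> nat list) problem" where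
  "Pow_problem C n =
     \<lparr> instances = {(m, w). alphabet {..<m} \<and> w \<in> lists {..<m} \<and> w \<noteq> []},
       yes = {(m, w). \<exists>h r. morphism {..<m} C h \<and> \<not> periodic {..<m} C h \<and>
                r \<in> lists C \<and> r \<noteq> [] \<and> h w = word_pow r n},
       encode = enc_pair enc_nat (enc_list enc_nat) \<rparr>"

definition EqSatCF :: "'c set \<Rightarrow> (nat \<times> nat equation list) problem" where
  "EqSatCF C =
     \<lparr> instances = {(m, es). alphabet {..<m} \<and> set es \<subseteq> lists {..<m} \<times> lists {..<m}},
       yes = {(m, es). \<exists>h. solution {..<m} C (set es) h \<and> \<not> periodic {..<m} C h},
       encode = enc_pair enc_nat
                  (enc_list (enc_pair (enc_list enc_nat) (enc_list enc_nat))) \<rparr>"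

lemma inj_encode_problems: "inj (encode (Pow_problem C n))" "inj (encode (EqSatCF C))"
  by (simp_all add: Pow_problem_def EqSatCF_def prefix_free_inj prefix_free_enc_nat
      prefix_free_enc_pair prefix_free_enc_list)

end

theory Submission
  imports Defs
begin

text \<open>For \<open>Pow(n) \<le> EqSatCF\<close>, map \<open>w\<close> to the equation \<open>w = z\<^sup>n\<close> with a fresh letter \<open>z\<close>. If a
  solution erases \<open>w\<close>, some letter does not occur in \<open>w\<close>, and one can redefine the morphism.

  For \<open>EqSatCF \<le> Pow(n)\<close>, replace \<open>u = v\<close> by the equations \<open>u z v = v z u\<close>, where \<open>z\<close> is empty or a
  letter. If \<open>h\<close> solves them and \<open>h v = h u \<cdot> s\<close>, then \<open>s\<close> commutes with all images of letters, so
  \<open>h u = h v\<close> unless \<open>h\<close> is periodic. In the new equations both sides have images of equal length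
  under every morphism. Hence concatenating all left and all right sides gives a single equivalent
  equation \<open>U = V\<close>, and \<open>U V\<^sup>n\<^sup>-\<^sup>1\<close> is mapped to an \<open>n\<close>-th power iff \<open>U = V\<close> holds.

  Both maps are computed by programs with finitely many read-only heads on the input and a
  write-only output. Since the output does not influence the control flow, such a program repeats
  no pair of control point and head positions before it halts, so it halts in polynomial time.\<close>

section \<open>Periodic morphisms\<close>

lemma word_pow_Suc: "word_pow r (Suc k) = r @ word_pow r k"
  by (simp add: word_pow_def)

lemma length_word_pow: "length (word_pow r k) = k * length r"
  by (induction k) (simp_all add: word_pow_def)

lemma word_pow_commute_root: "r @ word_pow r k = word_pow r k @ r"
  by (induction k) (simp_all add: word_pow_def)

lemma word_pow_add: "word_pow r (j + k) = word_pow r j @ word_pow r k"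
  by (simp add: word_pow_def replicate_add)

lemma word_pow_commute: "word_pow r j @ word_pow r k = word_pow r k @ word_pow r j"
  by (metis word_pow_add add.commute)

lemma commute_word_pow:
  "x @ s = s @ x \<Longrightarrow> x @ word_pow s k = word_pow s k @ x"
  by (induction k) (auto simp: word_pow_def, metis append.assoc)

text \<open>Since \<open>s\<close> is nonempty, some power of it is at least as long as
  \<open>x\<close> and \<open>y\<close> together. Both products commute with that power, so both are
  its prefix of length \<open>length x + length y\<close>.\<close>

lemma commute_trans:
  assumes x: "x @ s = s @ x" and y: "y @ s = s @ y" and s: "s \<noteq> []"
  shows "x @ y = y @ x"
proof -
  define N where "N = length x + length y"
  have N: "length (x @ y) \<le> length (word_pow s N)"
    using s by (cases s) (simp_all add: length_word_pow N_def)
  have "take (length (x @ y)) ((x @ y) @ word_pow s N) = take (length (x @ y)) (word_pow s N @ x @ y)"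
    "take (length (x @ y)) ((y @ x) @ word_pow s N) = take (length (x @ y)) (word_pow s N @ y @ x)"
    by (metis append.assoc x y commute_word_pow)+
  then have "x @ y = take (length (x @ y)) (word_pow s N)"
    "y @ x = take (length (x @ y)) (word_pow s N)"
    using N by simp_all
  with N show ?thesis by simp
qed

lemma append_eq_appendE:
  assumes "x @ x' = y @ y'" "length y \<le> length x"
  obtains z where "x = y @ z"
  using assms by (auto simp: append_eq_append_conv2)

text \<open>A shortest nonempty word commuting with \<open>s\<close> is a common root of all words commuting with
  \<open>s\<close>.\<close>

lemma periodic_if_commute:
  assumes s: "s \<noteq> []" "s \<in> lists C"
    and comm: "\<And>x. x \<in> A \<Longrightarrow> h [x] \<in> lists C \<and> h [x] @ s = s @ h [x]"
  shows "periodic A C h"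
proof -
  let ?P = "\<lambda>r. r \<in> lists C \<and> r \<noteq> [] \<and> r @ s = s @ r"
  obtain r where r: "?P r" and min: "\<And>y. ?P y \<Longrightarrow> length r \<le> length y"
    using ex_has_least_nat[of ?P s length] s by blast
  have "\<exists>k. y = word_pow r k" if "y \<in> lists C" "y @ s = s @ y" for y
    using that
  proof (induction y rule: length_induct)
    case (1 y)
    show ?case
    proof (cases "y = []")
      case True
      then show ?thesis by (auto simp: word_pow_def intro: exI[of _ 0])
    next
      case False
      \<comment> \<open>Both \<open>y\<close> and \<open>r\<close> commute with \<open>s\<close>,
        hence with each other, and \<open>r\<close> is a shortest choice. So \<open>r\<close> is a
        prefix of \<open>y\<close>, and the shorter remainder \<open>z\<close> commutes with
        \<open>s\<close> again.\<close>
      have "y @ r = r @ y" using commute_trans[OF 1(3) _ s(1)] r by blast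
      moreover have "length r \<le> length y" using min 1 False by blast
      ultimately obtain z where z: "y = r @ z"
        using append_eq_appendE by blast
      have "r @ (z @ s) = (s @ r) @ z" using 1(3) by (simp add: z)
      also have "\<dots> = (r @ s) @ z" using r by simp
      finally have "z @ s = s @ z" by simp
      moreover have "z \<in> lists C" "length z < length y" using z 1(2) r by auto
      ultimately obtain k where "z = word_pow r k" using 1(1) by blast
      then have "y = word_pow r (Suc k)" by (simp add: z word_pow_Suc)
      then show ?thesis by blast
    qed
  qed
  with comm r show ?thesis unfolding periodic_def by metis
qed

section \<open>Elementary properties of morphisms\<close>

lemma morphism_Nil: "morphism A C h \<Longrightarrow> h [] = []"
  unfolding morphism_def by (metis append_Nil append_self_conv lists.Nil)

lemma morphism_subset: "morphism B C h \<Longrightarrow> A \<subseteq> B \<Longrightarrow> morphism A C h"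
  unfolding morphism_def using lists_mono[of A B] by (simp add: subset_iff)

lemma morphism_append:
  "morphism A C h \<Longrightarrow> x \<in> lists A \<Longrightarrow> y \<in> lists A \<Longrightarrow> h (x @ y) = h x @ h y"
  unfolding morphism_def by blast

lemma concat_in_lists: "set xs \<subseteq> lists A \<Longrightarrow> concat xs \<in> lists A"
  by (induction xs) auto

lemma morphism_concat:
  "morphism A C h \<Longrightarrow> set xs \<subseteq> lists A \<Longrightarrow> h (concat xs) = concat (map h xs)"
proof (induction xs)
  case (Cons x xs)
  then have "concat xs \<in> lists A" by (intro concat_in_lists) auto
  with Cons show ?case by (simp add: morphism_append)
qed (simp add: morphism_Nil)

lemma morphism_word_pow:
  "morphism A C h \<Longrightarrow> x \<in> lists A \<Longrightarrow> h (word_pow x k) = word_pow (h x) k"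
  unfolding word_pow_def by (subst morphism_concat) auto

lemma morphism_letters:
  assumes "morphism A C h" "x \<in> lists A"
  shows "h x = concat (map (\<lambda>a. h [a]) x)"
proof -
  have "h (concat (map (\<lambda>a. [a]) x)) = concat (map h (map (\<lambda>a. [a]) x))"
    using assms by (intro morphism_concat) auto
  then show ?thesis by (simp add: comp_def)
qed

lemma morphism_concat_map:
  "(\<And>a. a \<in> A \<Longrightarrow> g a \<in> lists C) \<Longrightarrow> morphism A C (\<lambda>u. concat (map g u))"
  unfolding morphism_def by (auto simp: in_lists_conv_set)

lemma periodic_cong: "(\<And>x. x \<in> A \<Longrightarrow> h [x] = h' [x]) \<Longrightarrow> periodic A C h \<longleftrightarrow> periodic A C h'"
  by (simp add: periodic_def)

lemma periodic_subset: "periodic B C h \<Longrightarrow> A \<subseteq> B \<Longrightarrow> periodic A C h"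
  unfolding periodic_def by blast

text \<open>A morphism that erases all letters is periodic with the empty word as root.\<close>

lemma nonperiodic_imp_nonerasing:
  assumes "\<not> periodic A C h"
  obtains a where "a \<in> A" "h [a] \<noteq> []"
proof (cases "\<exists>a\<in>A. h [a] \<noteq> []")
  case False
  then have "\<forall>a\<in>A. h [a] = word_pow [] 0" by (simp add: word_pow_def)
  then have "periodic A C h" unfolding periodic_def by blast
  with assms show ?thesis by blast
qed (use that in blast)

section \<open>From powers to equations\<close>

text \<open>The nonempty word \<open>h w\<close> is a power of \<open>h [z]\<close> and also a power
  of the common root of the images of \<open>A\<close>. It therefore commutes with the image of
  every letter, \<open>z\<close> included.\<close>

lemma periodic_extend:
  assumes h: "morphism (insert z A) C h" and per: "periodic A C h"
    and w: "w \<in> lists A" "h w = word_pow (h [z]) n" "h w \<noteq> []"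
  shows "periodic (insert z A) C h"
proof (rule periodic_if_commute[OF w(3)])
  have "morphism A C h" using h by (rule morphism_subset) auto
  then show "h w \<in> lists C" using w(1) unfolding morphism_def by blast
  obtain r where r: "\<forall>x\<in>A. \<exists>k. h [x] = word_pow r k" using per unfolding periodic_def by blast
  have pow: "\<exists>k. h v = word_pow r k" if "v \<in> lists A" for v
    using that
  proof (induction v)
    case Nil
    then show ?case using morphism_Nil[OF h] by (auto simp: word_pow_def intro: exI[of _ 0])
  next
    case (Cons a v)
    then obtain j k where jk: "h [a] = word_pow r j" "h v = word_pow r k" using r by auto
    have "h ([a] @ v) = h [a] @ h v"
      using Cons.hyps by (intro morphism_append[OF h]) auto
    then have "h (a # v) = word_pow r (j + k)" by (simp add: jk word_pow_add)
    then show ?case by blast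
  qed
  fix x assume x: "x \<in> insert z A"
  show "h [x] \<in> lists C \<and> h [x] @ h w = h w @ h [x]"
  proof
    show "h [x] \<in> lists C" using h x by (auto simp: morphism_def)
    show "h [x] @ h w = h w @ h [x]"
    proof (cases "x = z")
      case True
      then show ?thesis by (simp add: w(2) word_pow_commute_root)
    next
      case False
      then obtain j k where "h [x] = word_pow r j" "h w = word_pow r k"
        using x pow[OF w(1)] r by auto
      then show ?thesis by (simp add: word_pow_commute)
    qed
  qed
qed

text \<open>The fresh letter \<open>z\<close> is sent to \<open>r\<close>; the image of
  \<open>w\<close> stays the same because \<open>z\<close> does not occur in it.\<close>

lemma extend_power_solution:
  assumes h: "morphism A C h" and z: "z \<notin> A" and w: "w \<in> lists A"
    and r: "r \<in> lists C" "h w = word_pow r n" and nonper: "\<not> periodic A C h"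
  shows "\<exists>h. solution (insert z A) C {(w, replicate n z)} h \<and> \<not> periodic (insert z A) C h"
proof (intro exI conjI)
  define g where "g = (\<lambda>x. if x = z then r else h [x])"
  let ?h = "\<lambda>u. concat (map g u)"
  have "morphism (insert z A) C ?h"
    using h r(1) by (intro morphism_concat_map) (auto simp: g_def morphism_def)
  moreover have "?h w = h w"
    using w z unfolding morphism_letters[OF h w]
    by (intro arg_cong[of _ _ concat] map_cong) (auto simp: g_def)
  moreover have "?h (replicate n z) = word_pow r n" by (simp add: g_def word_pow_def)
  ultimately show "solution (insert z A) C {(w, replicate n z)} ?h"
    using r(2) by (simp add: solution_def)
  have "periodic A C ?h \<longleftrightarrow> periodic A C h"
    using z by (intro periodic_cong) (auto simp: g_def)
  then show "\<not> periodic (insert z A) C ?h"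
    using nonper periodic_subset by blast
qed

text \<open>Some letter \<open>a\<close> is not erased, so it cannot occur in \<open>w\<close>. The
  new morphism sends the letters of \<open>w\<close> to the \<open>n\<close>-th power of
  \<open>c\<close> and all others, such as \<open>a\<close>, to \<open>d\<close>. Then
  \<open>w\<close> becomes a power of \<open>c\<close> with exponent \<open>n * length w\<close>,
  while \<open>c\<close> and \<open>d\<close> prevent a common root.\<close>

lemma power_of_erased_word:
  assumes h: "morphism A C h" and nonper: "\<not> periodic A C h"
    and w: "w \<in> lists A" "w \<noteq> []" "h w = []" and C: "c \<in> C" "d \<in> C" "c \<noteq> d" and n: "n > 0"
  shows "\<exists>h r. morphism A C h \<and> \<not> periodic A C h \<and> r \<in> lists C \<and> r \<noteq> [] \<and> h w = word_pow r n"
proof -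
  obtain a where a: "a \<in> A" "h [a] \<noteq> []" using nonperiodic_imp_nonerasing[OF nonper] .
  have "a \<notin> set w" using w(3) a(2) unfolding morphism_letters[OF h w(1)] by auto
  define g where "g = (\<lambda>x. if x \<in> set w then replicate n c else [d])"
  let ?h = "\<lambda>u. concat (map g u)"
  have "morphism A C ?h"
    using C by (intro morphism_concat_map) (auto simp: g_def)
  moreover have "\<not> periodic A C ?h"
  proof
    assume "periodic A C ?h"
    then obtain r where r: "\<And>x. x \<in> A \<Longrightarrow> \<exists>k. g x = word_pow r k" by (auto simp: periodic_def)
    have "hd w \<in> A" using w by (cases w) auto
    have "g (hd w) = replicate n c" using w(2) by (simp add: g_def)
    have "g a = [d]" using \<open>a \<notin> set w\<close> by (simp add: g_def)
    obtain j k where jk: "word_pow r k = [d]" "word_pow r j = replicate n c"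
      using r[OF a(1)] r[OF \<open>hd w \<in> A\<close>] \<open>g (hd w) = replicate n c\<close> \<open>g a = [d]\<close> by auto
    \<comment> \<open>A power of \<open>r\<close> equal to \<open>[d]\<close> forces all letters of
      \<open>r\<close> to be \<open>d\<close>, whereas \<open>c\<close> must occur in
      \<open>r\<close> because \<open>n > 0\<close> makes \<open>replicate n c\<close>
      nonempty.\<close>
    have "set (word_pow r j) \<subseteq> set r" by (auto simp: word_pow_def)
    then have "c \<in> set r" using n by (simp add: jk)
    moreover have "k \<noteq> 0" using jk(1) by (cases k) (simp_all add: word_pow_def)
    then have "set r = {d}" using arg_cong[OF jk(1), of set] by (simp add: word_pow_def)
    ultimately show False using C(3) by simp
  qed
  moreover have "?h w = word_pow (replicate (length w) c) n"
  proof -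
    have "map g w = map (\<lambda>_. replicate n c) w" by (simp add: g_def)
    then have "?h w = word_pow (replicate n c) (length w)"
      by (simp only: map_replicate_const word_pow_def)
    moreover have "word_pow (replicate i c) j = replicate (j * i) c" for i j
      by (induction j) (simp_all add: word_pow_def replicate_add)
    ultimately show ?thesis by (simp add: mult.commute)
  qed
  moreover have "replicate (length w) c \<in> lists C" "replicate (length w) c \<noteq> []"
    using w(2) C(1) by auto
  ultimately show ?thesis by blast
qed

text \<open>Conversely to extending by \<open>z\<close>, a solution of the equation is restricted to
  \<open>A\<close>. If \<open>h w\<close> is nonempty, the restriction stays nonperiodic by
  \<open>periodic_extend\<close>; if \<open>h w\<close> is empty, the restriction is still
  nonperiodic but gives no nonempty root, and \<open>power_of_erased_word\<close> replaces
  it.\<close>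

lemma power_iff_equation:
  assumes C: "alphabet C" and n: "n > 0" and z: "z \<notin> A" and w: "w \<in> lists A" "w \<noteq> []"
  shows "(\<exists>h r. morphism A C h \<and> \<not> periodic A C h \<and> r \<in> lists C \<and> r \<noteq> [] \<and> h w = word_pow r n)
    \<longleftrightarrow> (\<exists>h. solution (insert z A) C {(w, replicate n z)} h \<and> \<not> periodic (insert z A) C h)"
    (is "?pow \<longleftrightarrow> ?eq")
proof
  assume ?pow
  then show ?eq using extend_power_solution[OF _ z w(1)] by blast
next
  assume ?eq
  then obtain h where h: "morphism (insert z A) C h" "h w = h (replicate n z)"
    "\<not> periodic (insert z A) C h" by (auto simp: solution_def)
  have "replicate n z = word_pow [z] n" by (induction n) (simp_all add: word_pow_def)
  then have pow: "h w = word_pow (h [z]) n" using h morphism_word_pow[OF h(1), of "[z]"] by simp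
  have h': "morphism A C h" by (rule morphism_subset[OF h(1)]) auto
  show ?pow
  proof (cases "h w = []")
    case False
    then have "\<not> periodic A C h" using periodic_extend[OF h(1) _ w(1) pow] h(3) by blast
    moreover have "h [z] \<in> lists C" using h(1) by (auto simp: morphism_def)
    moreover have "h [z] \<noteq> []" using False pow by (auto simp: word_pow_def)
    ultimately show ?thesis using h' pow by blast
  next
    case True
    \<comment> \<open>The empty word is a power of every root, so leaving out \<open>z\<close>
      cannot make the morphism periodic.\<close>
    then have "h [z] = []" using pow n by (cases n) (auto simp: word_pow_def)
    then have "h [z] = word_pow r 0" for r by (simp add: word_pow_def)
    then have "\<not> periodic A C h" using h(3) unfolding periodic_def by blast
    moreover obtain c d where "c \<in> C" "d \<in> C" "c \<noteq> d"
    proof -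
      have "\<not> card C \<le> Suc 0" "finite C" using C by (simp_all add: alphabet_def)
      then show ?thesis using card_le_Suc0_iff_eq that by blast
    qed
    ultimately show ?thesis using power_of_erased_word[OF h' _ w True] n by blast
  qed
qed

section \<open>From equations to powers\<close>

text \<open>The surplus \<open>s\<close> of \<open>h v\<close> over \<open>h u\<close> commutes with
  \<open>h u\<close> by the equation without separator, and then with each \<open>h [z]\<close> by
  the equation with separator \<open>z\<close>. A nonempty \<open>s\<close> of this kind would make
  \<open>h\<close> periodic.\<close>

lemma eq_if_balanced_equations_aux:
  assumes h: "morphism A C h" and nonper: "\<not> periodic A C h"
    and u: "u \<in> lists A" and v: "v \<in> lists A" and uv: "h u @ h v = h v @ h u"
    and uzv: "\<And>z. z \<in> A \<Longrightarrow> h u @ h [z] @ h v = h v @ h [z] @ h u"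
    and le: "length (h u) \<le> length (h v)"
  shows "h u = h v"
proof -
  obtain s where s: "h v = h u @ s"
    using uv[symmetric] le append_eq_appendE by blast
  have us: "h u @ s = s @ h u" using uv by (simp add: s)
  have zs: "h [z] @ s = s @ h [z]" if "z \<in> A" for z
  proof -
    \<comment> \<open>The equation for \<open>z\<close> loses its common prefix \<open>h u\<close>;
      after \<open>h u\<close> and \<open>s\<close> are exchanged, \<open>h u\<close> also cancels
      on the right.\<close>
    have "(h [z] @ s) @ h u = (s @ h [z]) @ h u" using uzv[OF that] by (simp add: s flip: us)
    then show ?thesis by simp
  qed
  have z: "h [z] \<in> lists C" if "z \<in> A" for z using h that by (auto simp: morphism_def)
  have "h v \<in> lists C" using h v unfolding morphism_def by blast
  then have "s \<in> lists C" by (simp add: s)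
  then have "s = []" using nonper periodic_if_commute[of s C A h] zs z by blast
  then show ?thesis using s by simp
qed

lemma eq_if_balanced_equations:
  assumes h: "morphism A C h" and nonper: "\<not> periodic A C h"
    and u: "u \<in> lists A" and v: "v \<in> lists A" and uv: "h u @ h v = h v @ h u"
    and uzv: "\<And>z. z \<in> A \<Longrightarrow> h u @ h [z] @ h v = h v @ h [z] @ h u"
  shows "h u = h v"
proof (cases "length (h u) \<le> length (h v)")
  case True
  show ?thesis by (rule eq_if_balanced_equations_aux[OF h nonper u v uv uzv True])
next
  case False
  then have "h v = h u"
    by (intro eq_if_balanced_equations_aux[OF h nonper v u uv[symmetric] uzv[symmetric]]) auto
  then show ?thesis ..
qed

section \<open>The word that encodes a system of equations\<close>

definition separators :: "nat \<Rightarrow> nat list list" where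
  "separators m = [] # map (\<lambda>z. [z]) [0..<m]"

text \<open>The leading \<open>z\<close> is common to both sides of the combined equation. It makes
  every letter of the alphabet occur in \<open>side\<close>, also for the empty system, so that no
  nonperiodic morphism erases \<open>side\<close>.\<close>

definition block :: "nat equation list \<Rightarrow> nat list \<Rightarrow> nat list" where
  "block es z = z @ concat (map (\<lambda>(u, v). u @ z @ v) es)"

text \<open>The other side of the combined equation is \<open>side m (map prod.swap es)\<close>,
  since exchanging \<open>u\<close> and \<open>v\<close> turns \<open>u z v\<close> into
  \<open>v z u\<close>.\<close>

definition side :: "nat \<Rightarrow> nat equation list \<Rightarrow> nat list" where
  "side m es = concat (map (block es) (separators m))"

definition power_word :: "nat \<Rightarrow> nat \<Rightarrow> nat equation list \<Rightarrow> nat list" where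
  "power_word n m es = side m es @ word_pow (side m (map prod.swap es)) (n - 1)"

text \<open>This splits one equation back into many: with factors of equal lengths, the cutting
  points of the two concatenations coincide.\<close>

lemma concat_map_eqD:
  assumes "concat (map f xs) = concat (map g xs)" "\<And>x. x \<in> set xs \<Longrightarrow> length (f x) = length (g x)"
    "x \<in> set xs"
  shows "f x = g x"
proof -
  have "map f xs = map g xs"
    using assms by (intro concat_injective) (auto simp: zip_map1 zip_map2 zip_same_conv_map)
  then show ?thesis using assms(3) by simp
qed

lemma separators_in_lists: "z \<in> set (separators m) \<Longrightarrow> z \<in> lists {..<m}"
  by (auto simp: separators_def)

lemma block_in_lists:
  assumes "set es \<subseteq> lists {..<m} \<times> lists {..<m}" "z \<in> set (separators m)"
  shows "block es z \<in> lists {..<m}"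
proof -
  have "concat (map (\<lambda>(u, v). u @ z @ v) es) \<in> lists {..<m}"
    using assms(1) separators_in_lists[OF assms(2)]
    by (intro concat_in_lists) (auto dest!: subsetD[OF assms(1)])
  then show ?thesis using separators_in_lists[OF assms(2)]
    by (simp add: block_def)
qed

lemma side_in_lists:
  "set es \<subseteq> lists {..<m} \<times> lists {..<m} \<Longrightarrow> side m es \<in> lists {..<m}"
  unfolding side_def by (intro concat_in_lists, unfold set_map, intro image_subsetI block_in_lists)

context
  fixes m :: nat and C :: "'c set" and h :: "nat list \<Rightarrow> 'c list" and es :: "nat equation list"
  assumes h: "morphism {..<m} C h" and es: "set es \<subseteq> lists {..<m} \<times> lists {..<m}"
begin

lemma h_block:
  assumes "z \<in> set (separators m)"
  shows "h (block es z) = h z @ concat (map (\<lambda>(u, v). h u @ h z @ h v) es)"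
proof -
  note z = separators_in_lists[OF assms]
  have "h (u @ z @ v) = h u @ h z @ h v" if "(u, v) \<in> set es" for u v
  proof -
    have uv: "u \<in> lists {..<m}" "v \<in> lists {..<m}" using subsetD[OF es that] by auto
    then have "z @ v \<in> lists {..<m}" using z by simp
    with uv z show ?thesis by (simp only: morphism_append[OF h])
  qed
  then have 1: "map h (map (\<lambda>(u, v). u @ z @ v) es) = map (\<lambda>(u, v). h u @ h z @ h v) es"
    by auto
  have 2: "h (concat (map (\<lambda>(u, v). u @ z @ v) es))
      = concat (map h (map (\<lambda>(u, v). u @ z @ v) es))"
    using z by (intro morphism_concat[OF h]) (auto dest!: subsetD[OF es])
  have "h (concat (map (\<lambda>(u, v). u @ z @ v) es)) = concat (map (\<lambda>(u, v). h u @ h z @ h v) es)"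
    by (simp only: 1 2)
  moreover have "concat (map (\<lambda>(u, v). u @ z @ v) es) \<in> lists {..<m}"
    using block_in_lists[OF es assms] by (simp add: block_def)
  ultimately show ?thesis using z by (simp add: block_def morphism_append[OF h])
qed

lemma h_side: "h (side m es) = concat (map (\<lambda>z. h (block es z)) (separators m))"
  unfolding side_def using block_in_lists[OF es]
  by (subst morphism_concat[OF h]) (auto simp: comp_def)

end

lemma swap_in_lists: "set es \<subseteq> A \<times> A \<Longrightarrow> set (map prod.swap es) \<subseteq> A \<times> A"
  by auto

text \<open>The factors of \<open>u z v\<close> and \<open>v z u\<close> are the same up to order,
  so their images have equal length under any morphism.\<close>

lemma length_h_block_swap:
  assumes "morphism {..<m} C h" "set es \<subseteq> lists {..<m} \<times> lists {..<m}" "z \<in> set (separators m)"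
  shows "length (h (block es z)) = length (h (block (map prod.swap es) z))"
  using h_block[OF assms] h_block[OF assms(1) swap_in_lists[OF assms(2)] assms(3)]
  by (auto simp: length_concat comp_def case_prod_unfold intro!: arg_cong[of _ _ sum_list])

lemma length_h_side_swap:
  assumes "morphism {..<m} C h" "set es \<subseteq> lists {..<m} \<times> lists {..<m}"
  shows "length (h (side m es)) = length (h (side m (map prod.swap es)))"
  using h_side[OF assms] h_side[OF assms(1) swap_in_lists[OF assms(2)]] length_h_block_swap[OF assms]
  by (auto simp: length_concat comp_def intro!: arg_cong[of _ _ sum_list])

text \<open>Equality of the sides is split twice by lengths, first into the blocks of the separators
  and then into the single equations of a block. This yields all balanced equations, to which
  \<open>eq_if_balanced_equations\<close> applies.\<close>

lemma h_side_eq_iff: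
  assumes h: "morphism {..<m} C h" and nonper: "\<not> periodic {..<m} C h"
    and es: "set es \<subseteq> lists {..<m} \<times> lists {..<m}"
  shows "h (side m es) = h (side m (map prod.swap es)) \<longleftrightarrow> (\<forall>(u, v)\<in>set es. h u = h v)"
proof
  note swap = swap_in_lists[OF es]
  assume eq: "h (side m es) = h (side m (map prod.swap es))"
  have balanced: "h u @ h z @ h v = h v @ h z @ h u"
    if uv: "(u, v) \<in> set es" and z: "z \<in> set (separators m)" for u v z
  proof -
    have "h (block es z) = h (block (map prod.swap es) z)"
      using eq length_h_block_swap[OF h es] z unfolding h_side[OF h es] h_side[OF h swap]
      by (rule concat_map_eqD)
    then have *: "concat (map (\<lambda>(u, v). h u @ h z @ h v) es) = concat (map (\<lambda>(u, v). h v @ h z @ h u) es)"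
      using z by (simp add: h_block[OF h es] h_block[OF h swap] comp_def case_prod_unfold)
    show ?thesis using concat_map_eqD[OF * _ uv] by auto
  qed
  show "\<forall>(u, v)\<in>set es. h u = h v"
  proof clarify
    fix u v assume uv: "(u, v) \<in> set es"
    show "h u = h v"
    proof (rule eq_if_balanced_equations[OF h nonper])
      show "u \<in> lists {..<m}" "v \<in> lists {..<m}" using es uv by auto
      show "h u @ h v = h v @ h u"
        using balanced[OF uv, of "[]"] morphism_Nil[OF h] by (simp add: separators_def)
      show "h u @ h [z] @ h v = h v @ h [z] @ h u" if "z \<in> {..<m}" for z
        using balanced[OF uv, of "[z]"] that by (simp add: separators_def)
    qed
  qed
next
  note swap = swap_in_lists[OF es]
  assume eq: "\<forall>(u, v)\<in>set es. h u = h v"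
  have "map (\<lambda>(u, v). h u @ h z @ h v) es = map (\<lambda>(u, v). h v @ h z @ h u) es" for z
  proof (intro map_cong refl)
    fix e assume "e \<in> set es"
    with eq have "h (fst e) = h (snd e)" by auto
    then show "(case e of (u, v) \<Rightarrow> h u @ h z @ h v) = (case e of (u, v) \<Rightarrow> h v @ h z @ h u)"
      by (simp add: case_prod_unfold)
  qed
  then have "h (block es z) = h (block (map prod.swap es) z)" if "z \<in> set (separators m)" for z
    using that
    by (simp add: h_block[OF h es] h_block[OF h swap] comp_def case_prod_unfold del: map_eq_conv)
  then show "h (side m es) = h (side m (map prod.swap es))"
    unfolding h_side[OF h es] h_side[OF h swap] by (auto intro!: arg_cong[of _ _ concat])
qed

lemma h_side_nonempty:
  assumes h: "morphism {..<m} C h" and nonper: "\<not> periodic {..<m} C h"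
    and es: "set es \<subseteq> lists {..<m} \<times> lists {..<m}"
  shows "h (side m es) \<noteq> []"
proof -
  obtain a where a: "a < m" "h [a] \<noteq> []" using nonperiodic_imp_nonerasing[OF nonper]
    by (metis lessThan_iff)
  then have "a \<in> set (side m es)" by (auto simp: side_def block_def separators_def)
  then show ?thesis using a(2) unfolding morphism_letters[OF h side_in_lists[OF es]] by auto
qed

text \<open>The images of both sides have the same length, so in an \<open>n\<close>-th power
  \<open>r\<close> has that length too. Comparing the first two factors then gives
  \<open>h ?U = r = h ?V\<close>.\<close>

lemma equations_iff_power:
  assumes es: "set es \<subseteq> lists {..<m} \<times> lists {..<m}" and n: "n \<ge> 2"
  shows "(\<exists>h. solution {..<m} C (set es) h \<and> \<not> periodic {..<m} C h) \<longleftrightarrow>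
    (\<exists>h r. morphism {..<m} C h \<and> \<not> periodic {..<m} C h \<and> r \<in> lists C \<and> r \<noteq> []
       \<and> h (power_word n m es) = word_pow r n)"
proof -
  let ?U = "side m es" and ?V = "side m (map prod.swap es)"
  have U: "?U \<in> lists {..<m}" and V: "?V \<in> lists {..<m}"
    using side_in_lists[OF es] side_in_lists[OF swap_in_lists[OF es]] .
  have "(\<forall>(u, v)\<in>set es. h u = h v) \<longleftrightarrow>
     (\<exists>r. r \<in> lists C \<and> r \<noteq> [] \<and> h (power_word n m es) = word_pow r n)"
    if h: "morphism {..<m} C h" and nonper: "\<not> periodic {..<m} C h" for h
  proof -
    have Vk: "word_pow ?V (n - 1) \<in> lists {..<m}" using V by (auto simp: word_pow_def)
    have w: "h (power_word n m es) = h ?U @ word_pow (h ?V) (n - 1)"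
      unfolding power_word_def using morphism_append[OF h U Vk] morphism_word_pow[OF h V] by simp
    \<comment> \<open>With \<open>n = k + 2\<close> the image of the word starts with
      \<open>h ?U\<close> followed by \<open>h ?V\<close>, to be compared with \<open>r\<close>
      followed by \<open>r\<close>.\<close>
    obtain k where k: "n = Suc (Suc k)" using n by (metis add_2_eq_Suc le_Suc_ex)
    have "h ?U = h ?V \<longleftrightarrow> (\<exists>r. r \<in> lists C \<and> r \<noteq> [] \<and> h (power_word n m es) = word_pow r n)"
    proof
      assume "h ?U = h ?V"
      then have "h (power_word n m es) = word_pow (h ?U) n" unfolding w by (simp add: k word_pow_Suc)
      moreover have "h ?U \<in> lists C" using h U unfolding morphism_def by blast
      ultimately show "\<exists>r. r \<in> lists C \<and> r \<noteq> [] \<and> h (power_word n m es) = word_pow r n"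
        using h_side_nonempty[OF h nonper es] by blast
    next
      assume "\<exists>r. r \<in> lists C \<and> r \<noteq> [] \<and> h (power_word n m es) = word_pow r n"
      then obtain r where r: "h ?U @ h ?V @ word_pow (h ?V) k = r @ r @ word_pow r k"
        unfolding w by (auto simp: k word_pow_Suc)
      have len: "length (h ?U) = length (h ?V)" by (rule length_h_side_swap[OF h es])
      from arg_cong[OF r, of length] have "(k + 2) * length (h ?V) = (k + 2) * length r"
        using len by (simp add: length_word_pow)
      then have "length (h ?V) = length r" by (simp only: mult_cancel1) simp
      with r len show "h ?U = h ?V" by (simp add: append_eq_append_conv)
    qed
    then show ?thesis using h_side_eq_iff[OF h nonper es] by blast
  qed
  then show ?thesis unfolding solution_def by blast
qed

section \<open>Multi-head programs\<close>

definition cells :: "bool list \<Rightarrow> int \<Rightarrow> nat" where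
  "cells x = fst (input_tape x)"

text \<open>\<open>While i S p\<close> repeats \<open>p\<close> as long as head \<open>i\<close>
  reads a symbol in \<open>S\<close>. The symbols are \<open>0\<close> for the blank,
  \<open>1\<close> for \<open>False\<close> and \<open>2\<close> for \<open>True\<close>.\<close>

datatype prog = Skip | Out bool | Move nat dir | Seq prog prog (infixr ";;" 60)
  | While nat "nat set" prog

fun heads :: "prog \<Rightarrow> nat set" where
  "heads Skip = {}"
| "heads (Out b) = {}"
| "heads (Move i d) = {i}"
| "heads (p ;; q) = heads p \<union> heads q"
| "heads (While i S p) = insert i (heads p)"

type_synonym state = "(nat \<Rightarrow> int) \<times> bool list"

text \<open>One blank on each side of the input is allowed, which leaves \<open>length x + 2\<close>
  positions per head.\<close>

definition in_range :: "bool list \<Rightarrow> (nat \<Rightarrow> int) \<Rightarrow> bool" where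
  "in_range x ps \<longleftrightarrow> (\<forall>i. - 1 \<le> ps i \<and> ps i \<le> int (length x))"

text \<open>A derivation certifies termination and also that each move stays between the two blanks
  next to the input.\<close>

inductive exec :: "bool list \<Rightarrow> prog \<Rightarrow> state \<Rightarrow> state \<Rightarrow> bool" for x where
  Skip: "exec x Skip s s"
| Out: "exec x (Out b) (ps, out) (ps, out @ [b])"
| Move: "- 1 \<le> ps i + offset d \<Longrightarrow> ps i + offset d \<le> int (length x) \<Longrightarrow>
    exec x (Move i d) (ps, out) (ps(i := ps i + offset d), out)"
| Seq: "exec x p s s' \<Longrightarrow> exec x q s' s'' \<Longrightarrow> exec x (p ;; q) s s''"
| While_stop: "cells x (fst s i) \<notin> S \<Longrightarrow> exec x (While i S p) s s"
| While_step: "cells x (fst s i) \<in> S \<Longrightarrow> exec x p s s' \<Longrightarrow> exec x (While i S p) s' s'' \<Longrightarrow>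
    exec x (While i S p) s s''"

text \<open>\<open>I_Test i S t\<close> falls through if head \<open>i\<close> reads a symbol in \<open>S\<close>; otherwise it jumps to \<open>t\<close>.\<close>

datatype instr = I_Out bool | I_Move nat dir | I_Test nat "nat set" nat | I_Jump nat

section \<open>Compilation of programs to jump code\<close>

fun size_of :: "prog \<Rightarrow> nat" where
  "size_of Skip = 0"
| "size_of (Out b) = 1"
| "size_of (Move i d) = 1"
| "size_of (p ;; q) = size_of p + size_of q"
| "size_of (While i S p) = size_of p + 2"

text \<open>Jump targets are absolute, so \<open>a\<close> is the address at which the code is
  placed. A loop takes two extra instructions, the test in front and the jump back.\<close>

fun compile :: "prog \<Rightarrow> nat \<Rightarrow> instr list" where
  "compile Skip a = []"
| "compile (Out b) a = [I_Out b]"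
| "compile (Move i d) a = [I_Move i d]"
| "compile (p ;; q) a = compile p a @ compile q (a + size_of p)"
| "compile (While i S p) a =
     I_Test i S (a + size_of p + 2) # compile p (a + 1) @ [I_Jump a]"

lemma length_compile [simp]: "length (compile p a) = size_of p"
  by (induction p arbitrary: a) auto

fun wf_instr :: "nat \<Rightarrow> nat \<Rightarrow> instr \<Rightarrow> bool" where
  "wf_instr k l (I_Out b) = True"
| "wf_instr k l (I_Move i d) = (i < k)"
| "wf_instr k l (I_Test i S t) = (i < k \<and> t \<le> l)"
| "wf_instr k l (I_Jump t) = (t \<le> l)"

lemma wf_compile:
  "heads p \<subseteq> {..<k} \<Longrightarrow> a + size_of p \<le> l \<Longrightarrow> ins \<in> set (compile p a) \<Longrightarrow> wf_instr k l ins"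
proof (induction p arbitrary: a)
  case (Seq p q)
  then show ?case using Seq.IH(1)[of a] Seq.IH(2)[of "a + size_of p"] by auto
next
  case (While i S p)
  then show ?case using While.IH[of "a + 1"] by auto
qed auto

fun run_instr :: "bool list \<Rightarrow> instr \<Rightarrow> nat \<times> state \<Rightarrow> nat \<times> state" where
  "run_instr x (I_Out b) (c, ps, out) = (c + 1, ps, out @ [b])"
| "run_instr x (I_Move i d) (c, ps, out) = (c + 1, ps(i := ps i + offset d), out)"
| "run_instr x (I_Test i S t) (c, ps, out) = (if cells x (ps i) \<in> S then c + 1 else t, ps, out)"
| "run_instr x (I_Jump t) (c, ps, out) = (t, ps, out)"

definition code_step :: "bool list \<Rightarrow> instr list \<Rightarrow> nat \<times> state \<Rightarrow> nat \<times> state" where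
  "code_step x cs s = (if fst s < length cs then run_instr x (cs ! fst s) s else s)"

text \<open>Preservation of the range is recorded for each step, so that it holds at all
  intermediate times of a run; the counting of configurations relies on this.\<close>

definition safe_step :: "bool list \<Rightarrow> instr list \<Rightarrow> nat \<times> state \<Rightarrow> nat \<times> state \<Rightarrow> bool" where
  "safe_step x cs s s' \<longleftrightarrow> s' = code_step x cs s \<and>
     (in_range x (fst (snd s)) \<longrightarrow> in_range x (fst (snd s')))"

lemma safe_stepI:
  assumes "cs ! c = ins" "c < length cs" "run_instr x ins (c, s) = s'"
    "in_range x (fst s) \<Longrightarrow> in_range x (fst (snd s'))"
  shows "safe_step x cs (c, s) s'"
  using assms by (auto simp: safe_step_def code_step_def)

lemma code_step_halted: "fst s = length cs \<Longrightarrow> code_step x cs s = s"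
  by (simp add: code_step_def)

text \<open>The surrounding code \<open>pre\<close> and \<open>post\<close> is arbitrary so that the
  induction hypotheses apply to subprograms in place.\<close>

lemma exec_compile:
  assumes "exec x p s s'" and "cs = pre @ compile p (length pre) @ post"
  shows "(safe_step x cs)\<^sup>*\<^sup>* (length pre, s) (length pre + size_of p, s')"
  using assms
proof (induction arbitrary: pre post rule: exec.induct)
  case (Skip s)
  then show ?case by simp
next
  case (Out b ps out)
  then show ?case by (intro r_into_rtranclp safe_stepI[where ins = "I_Out b"]) auto
next
  case (Move ps i d out)
  then show ?case
    by (intro r_into_rtranclp safe_stepI[where ins = "I_Move i d"]) (auto simp: in_range_def)
next
  case (Seq p s s' q s'')
  have "(safe_step x cs)\<^sup>*\<^sup>* (length pre, s) (length pre + size_of p, s')"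
    using Seq.IH(1)[of pre "compile q (length pre + size_of p) @ post"] Seq.prems by simp
  moreover have "(safe_step x cs)\<^sup>*\<^sup>* (length pre + size_of p, s')
      (length pre + size_of p + size_of q, s'')"
    using Seq.IH(2)[of "pre @ compile p (length pre)" post] Seq.prems by simp
  ultimately show ?case by (simp add: add.assoc)
next
  case (While_stop s i S p)
  then show ?case
    by (intro r_into_rtranclp safe_stepI[where ins = "I_Test i S (length pre + size_of p + 2)"])
      (cases s; auto simp: nth_append)+
next
  case (While_step s i S p s' s'')
  let ?test = "I_Test i S (length pre + size_of p + 2)"
  have "safe_step x cs (length pre, s) (length pre + 1, s)"
    using While_step.prems While_step.hyps(1)
    by (intro safe_stepI[where ins = ?test]) (cases s; auto simp: nth_append)+
  moreover have "(safe_step x cs)\<^sup>*\<^sup>* (length pre + 1, s) (length pre + 1 + size_of p, s')"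
    using While_step.IH(1)[of "pre @ [?test]" "I_Jump (length pre) # post"] While_step.prems by simp
  moreover have "safe_step x cs (length pre + 1 + size_of p, s') (length pre, s')"
    using While_step.prems
    by (intro safe_stepI[where ins = "I_Jump (length pre)"]) (cases s'; auto simp: nth_append)+
  moreover have "(safe_step x cs)\<^sup>*\<^sup>* (length pre, s') (length pre + size_of (While i S p), s'')"
    using While_step.IH(2)[of pre post] While_step.prems by simp
  ultimately show ?case
    by (rule rtranclp_trans[OF converse_rtranclp_into_rtranclp
          [OF _ rtranclp_trans[OF _ r_into_rtranclp]]])
qed

lemma safe_steps_funpow:
  assumes "(safe_step x cs)\<^sup>*\<^sup>* s s'" and "in_range x (fst (snd s))"
  shows "\<exists>t. (code_step x cs ^^ t) s = s' \<and> (\<forall>j\<le>t. in_range x (fst (snd ((code_step x cs ^^ j) s))))"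
  using assms(1)
proof (induction rule: rtranclp_induct)
  case base
  then show ?case using assms(2) by (intro exI[of _ 0]) auto
next
  case (step s' s'')
  then obtain t where t: "(code_step x cs ^^ t) s = s'"
    "\<forall>j\<le>t. in_range x (fst (snd ((code_step x cs ^^ j) s)))" by auto
  with step(2) show ?case
    by (intro exI[of _ "Suc t"]) (auto simp: safe_step_def le_Suc_eq)
qed

text \<open>The output never influences the control flow, so until the code halts no pair of program
  counter and head positions repeats. This bounds the running time of any halting run.\<close>

lemma code_halting_time:
  assumes wf: "\<forall>ins\<in>set cs. wf_instr k (length cs) ins"
    and T: "fst ((code_step x cs ^^ T) s) = length cs"
    and range: "\<forall>j\<le>T. in_range x (fst (snd ((code_step x cs ^^ j) s)))"
    and start: "fst s \<le> length cs"
  obtains t where "t \<le> (length cs + 1) * (length x + 2) ^ k"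
    "(code_step x cs ^^ t) s = (code_step x cs ^^ T) s"
proof -
  \<comment> \<open>The projection \<open>\<pi>\<close> forgets the output. What remains determines
    its own successor, since no instruction reads the output.\<close>
  let ?F = "code_step x cs"
  define \<pi> :: "nat \<times> state \<Rightarrow> nat \<times> int list"
    where "\<pi> = (\<lambda>(c, ps, out). (c, map ps [0..<k]))"
  define t where "t = (LEAST t. fst ((?F ^^ t) s) = length cs)"
  have t: "fst ((?F ^^ t) s) = length cs" "t \<le> T"
    unfolding t_def using T by (auto intro: LeastI Least_le)
  have before: "fst ((?F ^^ j) s) \<noteq> length cs" if "j < t" for j
    using that not_less_Least unfolding t_def by blast
  have \<pi>_step: "\<pi> (?F a) = \<pi> (?F b)" if "\<pi> a = \<pi> b" for a b
  proof (cases "fst a < length cs")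
    case True
    obtain c ps out where a: "a = (c, ps, out)" by (cases a)
    obtain ps' out' where b: "b = (c, ps', out')" using \<open>\<pi> a = \<pi> b\<close> by (cases b) (simp add: \<pi>_def a)
    have eq: "ps i = ps' i" if "i < k" for i
      using \<open>\<pi> a = \<pi> b\<close> that by (auto simp: \<pi>_def a b map_eq_conv)
    have "wf_instr k (length cs) (cs ! c)" using wf True a by auto
    then show ?thesis using True a b eq
      by (cases "cs ! c") (auto simp: code_step_def \<pi>_def)
  next
    case False
    moreover have "fst b = fst a" using that by (auto simp: \<pi>_def split: prod.splits)
    ultimately show ?thesis using that by (simp add: code_step_def)
  qed
  have \<pi>_steps: "\<pi> ((?F ^^ j) a) = \<pi> ((?F ^^ j) b)" if "\<pi> a = \<pi> b" for a b j
    by (induction j) (auto intro: \<pi>_step that)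
  \<comment> \<open>If times \<open>i < j\<close> had the same projection, running both for
    \<open>t - j\<close> more steps would reach the halting address already at time
    \<open>t - j + i\<close>, before the first halting time \<open>t\<close>.\<close>
  have neq: "\<pi> ((?F ^^ i) s) \<noteq> \<pi> ((?F ^^ j) s)" if "i < j" "j \<le> t" for i j
  proof
    assume *: "\<pi> ((?F ^^ i) s) = \<pi> ((?F ^^ j) s)"
    have "\<pi> ((?F ^^ (t - j + i)) s) = \<pi> ((?F ^^ (t - j + j)) s)"
      unfolding funpow_add comp_def by (rule \<pi>_steps) (rule *)
    then have "fst ((?F ^^ (t - j + i)) s) = length cs"
      using t(1) that by (auto simp: \<pi>_def split: prod.splits)
    moreover have "t - j + i < t" using that by linarith
    ultimately show False using before by blast
  qed
  have inj: "inj_on (\<lambda>j. \<pi> ((?F ^^ j) s)) {..t}"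
    unfolding inj_on_def by (metis neq atMost_iff linorder_neqE_nat)
  \<comment> \<open>There are \<open>length cs + 1\<close> program counters, the halting address
    included, and \<open>length x + 2\<close> cells for each of the \<open>k\<close> heads.\<close>
  let ?B = "{..length cs} \<times> {ys. set ys \<subseteq> {- 1..int (length x)} \<and> length ys = k}"
  have pc_step: "fst (?F a) \<le> length cs" if "fst a \<le> length cs" for a
  proof (cases "fst a < length cs")
    case True
    obtain c ps out where a: "a = (c, ps, out)" by (cases a)
    have "wf_instr k (length cs) (cs ! c)" using wf True a by auto
    then show ?thesis using True a by (cases "cs ! c") (auto simp: code_step_def)
  qed (use that in \<open>simp add: code_step_def\<close>)
  have pc: "fst ((?F ^^ j) s) \<le> length cs" for j
    by (induction j) (auto intro: pc_step start)
  have "(\<lambda>j. \<pi> ((?F ^^ j) s)) ` {..t} \<subseteq> ?B"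
  proof (rule image_subsetI)
    fix j assume "j \<in> {..t}"
    then have "in_range x (fst (snd ((?F ^^ j) s)))" using range t by auto
    with pc[of j] show "\<pi> ((?F ^^ j) s) \<in> ?B"
      by (cases "(?F ^^ j) s") (auto simp: \<pi>_def in_range_def)
  qed
  then have "card {..t} \<le> card ?B"
    by (intro card_inj_on_le[OF inj]) (auto intro: finite_lists_length_eq)
  also have "card ?B = (length cs + 1) * (length x + 2) ^ k"
    by (simp add: card_cartesian_product card_lists_length_eq nat_add_distrib)
  finally have "t \<le> (length cs + 1) * (length x + 2) ^ k" by simp
  moreover have "(?F ^^ T) s = (?F ^^ t) s"
  proof -
    have "(?F ^^ j) ((?F ^^ t) s) = (?F ^^ t) s" for j
      by (induction j) (simp_all add: code_step_halted t(1))
    from this[of "T - t"] show ?thesis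
      using t(2) by (metis comp_apply funpow_add le_add_diff_inverse2)
  qed
  ultimately show ?thesis using that by metis
qed

section \<open>Turing machines for multi-head programs\<close>

definition keep :: "nat list \<Rightarrow> (nat \<times> dir) list" where
  "keep xs = map (\<lambda>a. (a, Stay)) xs"

fun instr_delta :: "nat \<Rightarrow> instr \<Rightarrow> nat \<Rightarrow> nat list \<Rightarrow> nat \<times> (nat \<times> dir) list" where
  "instr_delta k (I_Out b) q xs = (q + 1, (keep xs)[k := (bit_symbol b, Go_Right)])"
| "instr_delta k (I_Move i d) q xs = (q + 1, (keep xs)[i := (xs ! i, d)])"
| "instr_delta k (I_Test i S t) q xs = (if xs ! i \<in> S then q + 1 else t + 2, keep xs)"
| "instr_delta k (I_Jump t) q xs = (t + 2, keep xs)"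

text \<open>State \<open>0\<close> copies the input to the tapes \<open>0, \<dots>, k - 1\<close>, state \<open>1\<close> moves their heads to cell
  \<open>-1\<close>, and state \<open>c + 2\<close> executes the instruction at address \<open>c\<close>. Tape \<open>k\<close> is the output.\<close>

definition machine :: "nat \<Rightarrow> instr list \<Rightarrow> tm" where
  "machine k cs = \<lparr> tapes = k + 1, symbols = 3, states = length cs + 2,
     delta = (\<lambda>q xs.
       if q = 0 then
         (if xs ! 0 \<noteq> 0 then (0, replicate k (xs ! 0, Go_Right) @ [(xs ! k, Stay)])
          else (1, replicate k (0, Go_Left) @ [(xs ! k, Stay)]))
       else if q = 1 then
         (if xs ! 0 \<noteq> 0 then (1, map (\<lambda>a. (a, Go_Left)) (take k xs) @ [(xs ! k, Stay)])
          else (2, keep xs))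
       else instr_delta k (cs ! (q - 2)) q xs) \<rparr>"

lemma machine_simps [simp]:
  "tapes (machine k cs) = k + 1" "symbols (machine k cs) = 3" "states (machine k cs) = length cs + 2"
  by (simp_all add: machine_def)

lemma bit_symbol_bounds [simp]: "bit_symbol b < 3" "bit_symbol b \<noteq> 0"
  by (simp_all add: bit_symbol_def)

lemma wf_machine:
  assumes "k \<ge> 1" and wf: "\<forall>ins\<in>set cs. wf_instr k (length cs) ins"
  shows "wf_tm (machine k cs)"
proof -
  have "case delta (machine k cs) q xs of (q', as) \<Rightarrow>
      q' \<le> length cs + 2 \<and> length as = k + 1 \<and> fst ` set as \<subseteq> {..<3}"
    if q: "q < length cs + 2" and xs: "length xs = k + 1" "set xs \<subseteq> {..<3}" for q xs
  proof -
    have nth: "xs ! i < 3" if "i < k + 1" for i using xs that nth_mem by (metis lessThan_iff subsetD)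
    have keep: "length (keep xs) = k + 1" "fst ` set (keep xs) \<subseteq> {..<3}"
      using xs by (auto simp: keep_def)
    have upd: "fst ` set ((keep xs)[i := a]) \<subseteq> {..<3}" if "fst a < 3" for i a
      using that keep(2) set_update_subset_insert[of "keep xs" i a] by fastforce
    show ?thesis
    proof (cases "q < 2")
      case True
      then have "q = 0 \<or> q = 1" by auto
      then show ?thesis using xs nth[of 0] nth[of k] keep assms(1)
        by (auto simp: machine_def dest: in_set_takeD)
    next
      case False
      then have "wf_instr k (length cs) (cs ! (q - 2))" using wf q by auto
      then show ?thesis using False keep upd nth q xs
        by (cases "cs ! (q - 2)") (simp_all add: machine_def)
    qed
  qed
  then show ?thesis using assms(1) by (auto simp: wf_tm_def)
qed

section \<open>Simulation of the code by the machine\<close>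

definition tapes_of :: "nat \<Rightarrow> bool list \<Rightarrow> state \<Rightarrow> tape list" where
  "tapes_of k x s =
     map (\<lambda>i. (cells x, fst s i)) [0..<k] @ [(cells (snd s), int (length (snd s)))]"

definition config_of :: "nat \<Rightarrow> bool list \<Rightarrow> nat \<times> state \<Rightarrow> config" where
  "config_of k x s = (fst s + 2, tapes_of k x (snd s))"

lemma cells_snoc: "(cells out)(int (length out) := bit_symbol b) = cells (out @ [b])"
  by (rule ext) (auto simp: cells_def input_tape_def nth_append zless_nat_eq_int_zless)

lemma length_tapes_of [simp]: "length (tapes_of k x s) = k + 1"
  by (simp add: tapes_of_def)

lemma nth_tapes_of:
  "i < k \<Longrightarrow> tapes_of k x s ! i = (cells x, fst s i)"
  "tapes_of k x s ! k = (cells (snd s), int (length (snd s)))"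
  by (simp_all add: tapes_of_def nth_append)

lemma map2_act_keep: "map2 act (keep (map read_tape ts)) ts = ts"
proof (rule nth_equalityI)
  fix i assume "i < length (map2 act (keep (map read_tape ts)) ts)"
  then show "map2 act (keep (map read_tape ts)) ts ! i = ts ! i"
    by (cases "ts ! i") (simp add: keep_def)
qed (simp add: keep_def)

lemma map2_act_keep_update:
  assumes "i < length ts"
  shows "map2 act ((keep (map read_tape ts))[i := a]) ts = ts[i := act a (ts ! i)]"
proof -
  have "map2 act ((keep (map read_tape ts))[i := a]) ts
      = map2 act ((keep (map read_tape ts))[i := a]) (ts[i := ts ! i])" by simp
  also have "\<dots> = (map2 act (keep (map read_tape ts)) ts)[i := act a (ts ! i)]"
    by (simp only: zip_update map_update split)
  finally show ?thesis by (simp only: map2_act_keep)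
qed

lemma tapes_of_move:
  "i < k \<Longrightarrow> tapes_of k x (ps(i := p), out) = (tapes_of k x (ps, out))[i := (cells x, p)]"
  by (rule nth_equalityI) (auto simp: tapes_of_def nth_append nth_list_update)

lemma tapes_of_out:
  "tapes_of k x (ps, out @ [b])
    = (tapes_of k x (ps, out))[k := (cells (out @ [b]), int (length out) + 1)]"
  by (rule nth_equalityI) (auto simp: tapes_of_def nth_append nth_list_update)

text \<open>Each simulated head has its own unchanged copy of the input, and the output head stands
  on the first blank after the output. So one instruction is exactly one machine step.\<close>

lemma step_machine_code:
  assumes wf: "\<forall>ins\<in>set cs. wf_instr k (length cs) ins"
  shows "step (machine k cs) (config_of k x s) = config_of k x (code_step x cs s)"
proof (cases "fst s < length cs")
  case True
  obtain c ps out where s: "s = (c, ps, out)" by (cases s)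
  have ins: "wf_instr k (length cs) (cs ! c)" using wf True s by auto
  show ?thesis
  proof (cases "cs ! c")
    case (I_Out b)
    then show ?thesis using True
      by (simp add: s config_of_def code_step_def machine_def map2_act_keep_update nth_tapes_of
          cells_snoc tapes_of_out)
  next
    case (I_Move i d)
    then show ?thesis using True ins
      by (simp add: s config_of_def code_step_def machine_def map2_act_keep_update nth_tapes_of
          tapes_of_move)
  next
    case (I_Test i S t)
    then show ?thesis using True ins
      by (simp add: s config_of_def code_step_def machine_def map2_act_keep nth_tapes_of)
  next
    case (I_Jump t)
    then show ?thesis using True ins
      by (simp add: s config_of_def code_step_def machine_def map2_act_keep)
  qed
next
  case False
  then show ?thesis by (simp add: config_of_def code_step_def)
qed

lemma step_machine_code_funpow:
  assumes "\<forall>ins\<in>set cs. wf_instr k (length cs) ins"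
  shows "(step (machine k cs) ^^ t) (config_of k x s) = config_of k x ((code_step x cs ^^ t) s)"
  by (induction t) (simp_all add: step_machine_code[OF assms])

section \<open>Initialisation of the tapes\<close>

lemma machine_copies_input:
  assumes j: "j \<le> length x"
  shows "(step (machine (Suc k) cs) ^^ j) (init_config (machine (Suc k) cs) x)
    = (0, (cells x, int j) # replicate k (cells (take j x), int j) @ [(cells [], 0)])"
  using j
proof (induction j)
  case 0
  have "input_tape y = (cells y, 0)" for y by (simp add: cells_def input_tape_def)
  then show ?case by (simp add: init_config_def replicate_append_same)
next
  case (Suc j)
  let ?M = "machine (Suc k) cs" and ?b = "bit_symbol (x ! j)"
  let ?ts = "(cells x, int j) # replicate k (cells (take j x), int j) @ [(cells [], 0)]"
  have x: "cells x (int j) = ?b" using Suc.prems by (simp add: cells_def input_tape_def)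
  have "delta ?M 0 (map read_tape ?ts) = (0, replicate (Suc k) (?b, Go_Right) @ [(cells [] 0, Stay)])"
    by (simp add: machine_def x nth_append)
  then have "step ?M (0, ?ts) = (0, map2 act (replicate (Suc k) (?b, Go_Right) @ [(cells [] 0, Stay)]) ?ts)"
    by simp
  also have "map2 act (replicate (Suc k) (?b, Go_Right) @ [(cells [] 0, Stay)]) ?ts
     = ((cells x)(int j := ?b), int j + 1)
        # replicate k ((cells (take j x))(int j := ?b), int j + 1) @ [(cells [], 0)]"
    by (simp add: zip_replicate)
  also have "(cells x)(int j := ?b) = cells x" using x by auto
  also have "(cells (take j x))(int j := ?b) = cells (take (Suc j) x)"
    using cells_snoc[of "take j x" "x ! j"] Suc.prems by (simp add: take_Suc_conv_app_nth)
  finally show ?case using Suc by (simp add: add.commute)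
qed

lemma cells_outside: "p < 0 \<or> p \<ge> int (length x) \<Longrightarrow> cells x p = 0"
  by (auto simp: cells_def input_tape_def)

lemma cells_inside: "0 \<le> p \<Longrightarrow> p < int (length x) \<Longrightarrow> cells x p = bit_symbol (x ! nat p)"
  by (auto simp: cells_def input_tape_def)

lemma step_machine_copied:
  "step (machine (Suc k) cs)
      (0, (cells x, int (length x)) # replicate k (cells x, int (length x)) @ [(cells [], 0)])
    = (1, tapes_of (Suc k) x (\<lambda>_. int (length x) - 1, []))"
proof -
  have x: "cells x (int (length x)) = 0" by (simp add: cells_outside)
  then have [simp]: "(cells x)(int (length x) := 0) = cells x" by auto
  show ?thesis
    by (simp add: machine_def x nth_append zip_replicate tapes_of_def map_replicate_const
        del: upt_Suc)
qed

text \<open>All input heads stand at the same position, so the test on tape \<open>0\<close> decides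
  for all of them.\<close>

lemma step_machine_rewind:
  "step (machine (Suc k) cs) (1, tapes_of (Suc k) x (\<lambda>_. p, []))
    = (if cells x p \<noteq> 0 then (1, tapes_of (Suc k) x (\<lambda>_. p - 1, []))
       else (2, tapes_of (Suc k) x (\<lambda>_. p, [])))"
proof -
  have ts: "tapes_of (Suc k) x (\<lambda>_. p, [])
      = replicate (Suc k) (cells x, p) @ [(cells [], 0)]" for p
    by (simp add: tapes_of_def map_replicate_const del: upt_Suc replicate_Suc)
  show ?thesis
  proof (cases "cells x p = 0")
    case True
    then show ?thesis by (simp add: machine_def map2_act_keep nth_tapes_of)
  next
    case False
    then have "step (machine (Suc k) cs) (1, tapes_of (Suc k) x (\<lambda>_. p, []))
      = (1, map2 act (replicate (Suc k) (cells x p, Go_Left) @ [(cells [] 0, Stay)])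
          (replicate (Suc k) (cells x, p) @ [(cells [], 0)]))"
      by (simp add: machine_def ts nth_append)
    with False show ?thesis
      by (simp add: ts nth_append zip_replicate del: replicate_Suc)
  qed
qed

lemma machine_rewinds:
  "j \<le> length x \<Longrightarrow> (step (machine (Suc k) cs) ^^ j) (1, tapes_of (Suc k) x (\<lambda>_. int (length x) - 1, []))
    = (1, tapes_of (Suc k) x (\<lambda>_. int (length x) - 1 - int j, []))"
proof (induction j)
  case (Suc j)
  then have "cells x (int (length x) - 1 - int j) \<noteq> 0" by (subst cells_inside) auto
  with Suc show ?case by (simp del: step.simps One_nat_def add: step_machine_rewind algebra_simps)
qed simp

lemma machine_initialises:
  "(step (machine (Suc k) cs) ^^ (2 * length x + 2)) (init_config (machine (Suc k) cs) x)
    = config_of (Suc k) x (0, \<lambda>_. - 1, [])"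
proof -
  let ?S = "step (machine (Suc k) cs)" and ?l = "length x"
  \<comment> \<open>The steps are \<open>?l\<close> for copying, one to turn back at the blank,
    \<open>?l\<close> to move left to cell \<open>-1\<close>, and one to enter the code.\<close>
  have "(?S ^^ (2 * ?l + 2)) c = ?S ((?S ^^ ?l) (?S ((?S ^^ ?l) c)))" for c
  proof -
    have "2 * ?l + 2 = Suc (?l + Suc ?l)" by simp
    then show ?thesis by (simp only: funpow.simps(2) funpow_add comp_apply)
  qed
  then show ?thesis
    by (simp del: step.simps One_nat_def funpow.simps add: machine_copies_input step_machine_copied machine_rewinds
        step_machine_rewind cells_outside config_of_def)
qed

lemma halts_with_config_of:
  assumes "c = length cs"
  shows "halts_with (machine k cs) (config_of k x (c, ps, out)) out"
  using assms by (auto simp: halts_with_def config_of_def tapes_of_def cells_def input_tape_def)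

text \<open>For a reduction it thus suffices to give a program and the output of its run; no running
  time has to be computed for it.\<close>

theorem exec_poly_time:
  assumes heads: "heads p \<subseteq> {..<k}"
    and exec: "\<And>a. a \<in> X \<Longrightarrow> \<exists>ps. exec (enc a) p (\<lambda>_. - 1, []) (ps, enc' (f a))"
  shows "poly_time_computable X enc enc' f"
proof -
  define cs where "cs = compile p 0"
  define M where "M = machine (Suc k) cs"
  have wf: "\<forall>ins\<in>set cs. wf_instr (Suc k) (length cs) ins"
    unfolding cs_def using heads by (auto intro!: wf_compile)
  \<comment> \<open>The linear summand pays for the initialisation, the other one for the run of the
    code. Taking \<open>Suc k\<close> heads guarantees at least one input tape.\<close>
  define P :: "nat poly"
    where "P = [:2, 2:] + smult (length cs + 1) ([:2, 1:] ^ Suc k)"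
  have "\<exists>t\<le>poly P (length (enc a)).
      halts_with M ((step M ^^ t) (init_config M (enc a))) (enc' (f a))" if "a \<in> X" for a
  proof -
    let ?x = "enc a"
    let ?s = "(0, \<lambda>_. - 1, []) :: nat \<times> state"
    obtain ps where "exec ?x p (\<lambda>_. - 1, []) (ps, enc' (f a))" using exec[OF \<open>a \<in> X\<close>] by auto
    from exec_compile[OF this, of "cs" "[]" "[]"]
    have "(safe_step ?x cs)\<^sup>*\<^sup>* ?s (length cs, ps, enc' (f a))" by (simp add: cs_def)
    from safe_steps_funpow[OF this] obtain T
      where T: "(code_step ?x cs ^^ T) ?s = (length cs, ps, enc' (f a))"
        "\<forall>j\<le>T. in_range ?x (fst (snd ((code_step ?x cs ^^ j) ?s)))"
      by (auto simp: in_range_def)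
    obtain t where t: "t \<le> (length cs + 1) * (length ?x + 2) ^ Suc k"
      "(code_step ?x cs ^^ t) ?s = (length cs, ps, enc' (f a))"
      by (rule code_halting_time[OF wf _ T(2)]) (use T(1) in auto)
    have "(step M ^^ (t + (2 * length ?x + 2))) (init_config M ?x)
        = config_of (Suc k) ?x (length cs, ps, enc' (f a))"
      by (simp only: M_def funpow_add[of t] comp_apply machine_initialises
          step_machine_code_funpow[OF wf] t(2))
    moreover have "halts_with M (config_of (Suc k) ?x (length cs, ps, enc' (f a))) (enc' (f a))"
      unfolding M_def by (rule halts_with_config_of) simp
    moreover have "t + (2 * length ?x + 2) \<le> poly P (length ?x)"
      using t(1) by (simp add: P_def algebra_simps)
    ultimately show ?thesis by metis
  qed
  moreover have "wf_tm M" unfolding M_def using wf by (intro wf_machine) auto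
  ultimately show ?thesis unfolding poly_time_computable_def by blast
qed

section \<open>Scanning programs\<close>

lemma exec_Out: "s' = (ps, out @ [b]) \<Longrightarrow> exec x (Out b) (ps, out) s'"
  by (simp add: exec.Out)

lemma exec_Move:
  "\<lbrakk>- 1 \<le> ps i + offset d; ps i + offset d \<le> int (length x); s' = (ps(i := ps i + offset d), out)\<rbrakk>
    \<Longrightarrow> exec x (Move i d) (ps, out) s'"
  by (simp add: exec.Move)

section \<open>Occurrences of words on the input tape\<close>

definition occurs_at :: "bool list \<Rightarrow> int \<Rightarrow> bool list \<Rightarrow> bool" where
  "occurs_at x p y \<longleftrightarrow> (\<exists>pre post. x = pre @ y @ post \<and> p = int (length pre))"

lemma occurs_at_self: "occurs_at x 0 x"
  unfolding occurs_at_def by (intro exI[of _ "[]"]) simp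

lemma occurs_at_prefix: "occurs_at x p (y @ z) \<Longrightarrow> occurs_at x p y"
  unfolding occurs_at_def by auto

lemma occurs_at_suffix: "occurs_at x p (y @ z) \<Longrightarrow> occurs_at x (p + int (length y)) z"
  unfolding occurs_at_def
  by (metis append.assoc length_append of_nat_add)

lemma occurs_at_bounds: "occurs_at x p y \<Longrightarrow> 0 \<le> p \<and> p + int (length y) \<le> int (length x)"
  unfolding occurs_at_def by auto

lemma occurs_at_ConsD:
  assumes "occurs_at x p (b # y)"
  shows "cells x p = bit_symbol b" "occurs_at x (p + 1) y" "0 \<le> p" "p + 1 \<le> int (length x)"
proof -
  obtain pre post where x: "x = pre @ (b # y) @ post" "p = int (length pre)"
    using assms unfolding occurs_at_def by auto
  then show "cells x p = bit_symbol b" by (simp add: cells_inside)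
  show "occurs_at x (p + 1) y" using occurs_at_suffix[of x p "[b]" y] assms by simp
  show "0 \<le> p" "p + 1 \<le> int (length x)" using x by auto
qed

lemma occurs_at_cells: "occurs_at x p y \<Longrightarrow> i < length y \<Longrightarrow> cells x (p + int i) = bit_symbol (y ! i)"
  unfolding occurs_at_def by (auto simp: cells_inside nth_append nat_add_distrib)

text \<open>This is \<open>enc_list enc_nat\<close> without the closing \<open>False\<close>. The
  mark \<open>True\<close> before an item merges with the unary number into
  \<open>enc_nat (Suc a)\<close>, and in contrast to \<open>enc_list\<close> the map respects
  concatenation.\<close>

definition letters :: "nat list \<Rightarrow> bool list" where
  "letters w = concat (map (\<lambda>a. enc_nat (Suc a)) w)"

lemma letters_simps [simp]:
  "letters [] = []" "letters (a # w) = enc_nat (Suc a) @ letters w" "letters (v @ w) = letters v @ letters w"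
  by (simp_all add: letters_def)

lemma enc_list_enc_nat: "enc_list enc_nat w = letters w @ [False]"
  by (simp add: enc_list_def letters_def enc_nat_def)

text \<open>The flag \<open>e\<close> lets the same scanning program serve both for skipping a part
  of the input and for copying it.\<close>

definition emit :: "bool \<Rightarrow> bool \<Rightarrow> prog" where
  "emit e b = (if e then Out b else Skip)"

lemma exec_emit: "exec x (emit e b) (ps, out) (ps, out @ (if e then [b] else []))"
  by (simp add: emit_def exec.Out exec.Skip)

definition unary :: "bool \<Rightarrow> nat \<Rightarrow> prog" where
  "unary e i = While i {2} (emit e True ;; Move i Go_Right)"

lemma exec_unary:
  "occurs_at x (ps i) (enc_nat a) \<Longrightarrow>
    exec x (unary e i) (ps, out)
      (ps(i := ps i + int a), out @ (if e then replicate a True else []))"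
proof (induction a arbitrary: ps out)
  case 0
  then show ?case
    using exec.While_stop[of x "(ps, out)" i "{2}"] occurs_at_ConsD(1)[of x "ps i" False "[]"]
    by (simp add: unary_def enc_nat_def bit_symbol_def)
next
  case (Suc a)
  then have 1: "occurs_at x (ps i) (True # enc_nat a)" by (simp add: enc_nat_def)
  let ?out = "out @ (if e then [True] else [])"
  let ?ps = "ps(i := ps i + 1)"
  have step: "exec x (emit e True ;; Move i Go_Right) (ps, out) (?ps, ?out)"
    using occurs_at_ConsD[OF 1] by (intro exec.Seq[OF exec_emit exec_Move]) auto
  have "exec x (unary e i) (?ps, ?out)
      (?ps(i := ?ps i + int a), ?out @ (if e then replicate a True else []))"
    using occurs_at_ConsD[OF 1] by (intro Suc.IH) simp
  moreover have "cells x (fst (ps, out) i) \<in> {2}"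
    using occurs_at_ConsD(1)[OF 1] by (simp add: bit_symbol_def)
  moreover have "(?ps(i := ?ps i + int a), ?out @ (if e then replicate a True else []))
      = (ps(i := ps i + int (Suc a)), out @ (if e then replicate (Suc a) True else []))"
    by auto
  ultimately show ?case using exec.While_step[OF _ step] unfolding unary_def by metis
qed

definition field :: "bool \<Rightarrow> nat \<Rightarrow> prog" where
  "field e i = unary e i ;; emit e False ;; Move i Go_Right"

lemma exec_field:
  assumes "occurs_at x (ps i) (enc_nat a)"
  shows "exec x (field e i) (ps, out)
      (ps(i := ps i + int (length (enc_nat a))), out @ (if e then enc_nat a else []))"
  unfolding field_def using occurs_at_bounds[OF assms]
  by (intro exec.Seq[OF exec_unary[of x ps i a, OF assms] exec.Seq[OF exec_emit exec_Move]])
    (auto simp: enc_nat_def)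

definition items :: "bool \<Rightarrow> nat \<Rightarrow> prog" where
  "items e i = While i {2} (field e i)"

lemma exec_items:
  "occurs_at x (ps i) (enc_list enc_nat w) \<Longrightarrow>
    exec x (items e i) (ps, out)
      (ps(i := ps i + int (length (letters w))), out @ (if e then letters w else []))"
proof (induction w arbitrary: ps out)
  case Nil
  then show ?case
    using exec.While_stop[of x "(ps, out)" i "{2}"] occurs_at_ConsD(1)[of x "ps i" False "[]"]
    by (simp add: items_def enc_list_def bit_symbol_def)
next
  case (Cons a w)
  then have 1: "occurs_at x (ps i) (enc_nat (Suc a) @ enc_list enc_nat w)"
    by (simp add: enc_list_enc_nat)
  let ?out = "out @ (if e then enc_nat (Suc a) else [])"
  let ?ps = "ps(i := ps i + int (length (enc_nat (Suc a))))"
  have step: "exec x (field e i) (ps, out) (?ps, ?out)"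
    using exec_field occurs_at_prefix[OF 1] by blast
  have "exec x (items e i) (?ps, ?out)
      (?ps(i := ?ps i + int (length (letters w))), ?out @ (if e then letters w else []))"
    using occurs_at_suffix[OF 1] by (intro Cons.IH) simp
  moreover have "cells x (fst (ps, out) i) \<in> {2}"
    using occurs_at_ConsD(1)[of x "ps i" True] occurs_at_prefix[OF 1]
    by (simp add: bit_symbol_def enc_nat_def)
  moreover have "(?ps(i := ?ps i + int (length (letters w))), ?out @ (if e then letters w else []))
      = (ps(i := ps i + int (length (letters (a # w)))), out @ (if e then letters (a # w) else []))"
    by auto
  ultimately show ?case using exec.While_step[OF _ step] unfolding items_def by metis
qed

definition scan_word :: "bool \<Rightarrow> nat \<Rightarrow> prog" where
  "scan_word e i = items e i ;; Move i Go_Right"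

lemma exec_scan_word:
  assumes "occurs_at x (ps i) (enc_list enc_nat w)"
  shows "exec x (scan_word e i) (ps, out)
      (ps(i := ps i + int (length (enc_list enc_nat w))), out @ (if e then letters w else []))"
  unfolding scan_word_def using occurs_at_bounds[OF assms]
  by (intro exec.Seq[OF exec_items[of x ps i w, OF assms] exec_Move]) (auto simp: enc_list_enc_nat)

definition rewind :: "nat \<Rightarrow> prog" where
  "rewind i = While i {1, 2} (Move i Go_Left)"

lemma cells_nonblank: "0 \<le> p \<Longrightarrow> p < int (length x) \<Longrightarrow> cells x p \<in> {1, 2}"
  by (simp add: cells_inside bit_symbol_def)

lemma exec_rewind:
  assumes "- 1 \<le> ps i" "ps i < int (length x)"
  shows "exec x (rewind i) (ps, out) (ps(i := - 1), out)"
  using assms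
proof (induction "nat (ps i + 1)" arbitrary: ps)
  case 0
  then have "ps i = - 1" by simp
  then have "ps(i := - 1) = ps" by auto
  then show ?case using exec.While_stop[of x "(ps, out)" i "{1, 2}"] \<open>ps i = - 1\<close>
    by (simp add: rewind_def cells_outside)
next
  case (Suc k)
  let ?ps = "ps(i := ps i - 1)"
  have "exec x (rewind i) (?ps, out) (?ps(i := - 1), out)"
    using Suc by (intro Suc.hyps(1)) auto
  moreover have "exec x (Move i Go_Left) (ps, out) (?ps, out)"
    using Suc by (intro exec_Move) auto
  moreover have "cells x (fst (ps, out) i) \<in> {1, 2}"
    using Suc unfolding fst_conv by (intro cells_nonblank) auto
  ultimately show ?case unfolding rewind_def using exec.While_step by (metis fun_upd_upd)
qed

text \<open>The number \<open>m\<close> is read afresh from the front of the input each time, so it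
  can be printed repeatedly without being stored. The head ends on the \<open>False\<close> at cell
  \<open>m\<close>.\<close>

definition header :: "bool \<Rightarrow> nat \<Rightarrow> prog" where
  "header e i = rewind i ;; Move i Go_Right ;; unary e i"

lemma exec_header:
  assumes x: "x = enc_nat m @ y" and i: "- 1 \<le> ps i" "ps i < int (length x)"
  shows "exec x (header e i) (ps, out) (ps(i := int m), out @ (if e then replicate m True else []))"
proof -
  let ?ps = "ps(i := 0)"
  have "occurs_at x (?ps i) (enc_nat m)"
    using occurs_at_prefix[of x 0 "enc_nat m" y] occurs_at_self[of x] x by simp
  from exec_unary[of x ?ps, OF this]
  have "exec x (unary e i) (?ps, out) (ps(i := int m), out @ (if e then replicate m True else []))"
    by simp
  moreover have "exec x (Move i Go_Right) (ps(i := - 1), out) (?ps, out)"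
    by (intro exec_Move) auto
  ultimately show ?thesis unfolding header_def
    by (intro exec.Seq[OF exec_rewind[of ps, OF i] exec.Seq])
qed

section \<open>The program for powers to equations\<close>

fun repeat_prog :: "nat \<Rightarrow> prog \<Rightarrow> prog" where
  "repeat_prog 0 p = Skip"
| "repeat_prog (Suc n) p = p ;; repeat_prog n p"

lemma heads_repeat_prog: "heads (repeat_prog n p) \<subseteq> heads p"
  by (induction n) auto

text \<open>The number of repetitions is a constant of the problem, so the loop is unrolled. The
  invariant \<open>I\<close> is used because a pass may leave the heads at other positions than it
  found them.\<close>

lemma exec_repeat_prog:
  assumes "\<And>ps out. I ps \<Longrightarrow> \<exists>ps'. I ps' \<and> exec x p (ps, out) (ps', out @ y)"
  shows "I ps \<Longrightarrow> \<exists>ps'. I ps' \<and> exec x (repeat_prog n p) (ps, out) (ps', out @ concat (replicate n y))"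
proof (induction n arbitrary: ps out)
  case 0
  then show ?case by (auto intro: exec.Skip)
next
  case (Suc n)
  obtain ps' where 1: "I ps'" "exec x p (ps, out) (ps', out @ y)" using assms Suc.prems by blast
  obtain ps'' where 2: "I ps''"
    "exec x (repeat_prog n p) (ps', out @ y) (ps'', (out @ y) @ concat (replicate n y))"
    using Suc.IH[OF 1(1)] by blast
  show ?case using 2(1) exec.Seq[OF 1(2) 2(2)] by auto
qed

text \<open>The first \<open>Out True\<close> raises \<open>m\<close> to \<open>m + 1\<close>,
  making room for the fresh letter \<open>m\<close>; the second one marks the only equation of the
  list. After \<open>w\<close> is closed, each repetition prints the letter \<open>m\<close>, and
  the last two \<open>False\<close> close the right-hand side and the list.\<close>

definition pow_to_eq :: "nat \<Rightarrow> prog" where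
  "pow_to_eq n = Out True ;; header True 0 ;; Out False ;; Move 0 Go_Right ;; Out True ;;
     items True 0 ;; Out False ;; repeat_prog n (Out True ;; header True 0 ;; Out False) ;;
     Out False ;; Out False"

lemma heads_pow_to_eq: "heads (pow_to_eq n) \<subseteq> {..<1}"
  using heads_repeat_prog[of n "Out True ;; header True 0 ;; Out False"]
  by (auto simp: pow_to_eq_def header_def rewind_def unary_def items_def field_def emit_def)

lemma exec_pow_to_eq:
  assumes x: "x = enc_nat m @ enc_list enc_nat w"
  shows "\<exists>ps. exec x (pow_to_eq n) (\<lambda>_. - 1, []) (ps,
    enc_pair enc_nat (enc_list (enc_pair (enc_list enc_nat) (enc_list enc_nat)))
      (m + 1, [(w, replicate n m)]))"
proof -
  let ?I = "\<lambda>ps::nat \<Rightarrow> int. - 1 \<le> ps 0 \<and> ps 0 < int (length x)"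
  have len: "int (length x) = int m + 2 + int (length (letters w))"
    by (simp add: x enc_nat_def enc_list_enc_nat)
  let ?ps1 = "(\<lambda>_. - 1)(0 := int m) :: nat \<Rightarrow> int"
  let ?ps2 = "(\<lambda>_. - 1)(0 := int m + 1) :: nat \<Rightarrow> int"
  let ?ps3 = "?ps2(0 := ?ps2 0 + int (length (letters w)))"
  let ?o1 = "[True] @ replicate m True"
  let ?o2 = "?o1 @ [False, True]"
  let ?o3 = "(?o2 @ letters w) @ [False]"
  have 1: "exec x (header True 0) (\<lambda>_. - 1, [True]) (?ps1, ?o1)"
    using exec_header[OF x, of "\<lambda>_. - 1" 0 True "[True]"] by simp
  have "occurs_at x (?ps2 0) (enc_list enc_nat w)"
    using occurs_at_suffix[of x 0 "enc_nat m" "enc_list enc_nat w"] occurs_at_self[of x] x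
    by (simp add: enc_nat_def add.commute)
  from exec_items[of x ?ps2, OF this, of True ?o2]
  have 2: "exec x (items True 0) (?ps2, ?o2) (?ps3, ?o2 @ letters w)" by simp
  have loop: "\<exists>ps'. ?I ps' \<and> exec x (Out True ;; header True 0 ;; Out False) (ps, out)
      (ps', out @ (True # enc_nat m))" if "?I ps" for ps out
  proof -
    have "exec x (header True 0) (ps, out @ [True]) (ps(0 := int m), (out @ [True]) @ replicate m True)"
      using exec_header[OF x, of ps 0 True "out @ [True]"] that by simp
    then have "exec x (Out True ;; header True 0 ;; Out False) (ps, out)
        (ps(0 := int m), out @ (True # enc_nat m))"
      by (intro exec.Seq[OF exec_Out[OF refl]] exec.Seq[OF _ exec_Out]) (simp_all add: enc_nat_def)
    then show ?thesis using len by (intro exI[of _ "ps(0 := int m)"]) simp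
  qed
  have ok: "?I ?ps3" using len by simp
  obtain ps where 3: "exec x (repeat_prog n (Out True ;; header True 0 ;; Out False)) (?ps3, ?o3)
      (ps, ?o3 @ concat (replicate n (True # enc_nat m)))"
    using exec_repeat_prog[of ?I, OF loop, of ?ps3 n ?o3] ok by blast
  let ?o4 = "?o3 @ concat (replicate n (True # enc_nat m))"
  have 4: "exec x (Move 0 Go_Right) (?ps1, ?o1 @ [False]) (?ps2, ?o1 @ [False])"
    using len by (intro exec_Move) auto
  have 5: "exec x (Out True) (?ps2, ?o1 @ [False]) (?ps2, ?o2)"
    by (rule exec_Out) simp
  have "exec x (pow_to_eq n) (\<lambda>_. - 1, []) (ps, (?o4 @ [False]) @ [False])"
    unfolding pow_to_eq_def using 1
    by (intro exec.Seq[OF exec_Out[OF refl]] exec.Seq[OF 4 exec.Seq[OF 5 exec.Seq[OF 2]]]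
        exec.Seq[OF 3] exec_Out[OF refl] exec.Seq[of x _ _ "(?ps1, ?o1)"]) simp
  moreover have "(?o4 @ [False]) @ [False] =
    enc_pair enc_nat (enc_list (enc_pair (enc_list enc_nat) (enc_list enc_nat)))
      (m + 1, [(w, replicate n m)])"
    by (simp add: enc_pair_def enc_list_def enc_nat_def letters_def map_replicate_const)
  ultimately show ?thesis by auto
qed

section \<open>The program for equations to powers\<close>

text \<open>Head \<open>2\<close> holds the current separator: it is at cell \<open>z\<close> for the letter \<open>z\<close> and at cell \<open>-1\<close> for
  the empty separator, in which case the outer loop of \<open>print_separator\<close> is skipped. Head \<open>3\<close> is
  only used to restore head \<open>2\<close>.\<close>

definition print_separator :: prog where
  "print_separator =
     While 2 {1, 2} (While 2 {1, 2} (Out True ;; Move 2 Go_Left ;; Move 3 Go_Right) ;; Out False) ;;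
     While 3 {1, 2} (Move 3 Go_Left ;; Move 2 Go_Right)"

definition separator_at :: "int \<Rightarrow> nat list" where
  "separator_at p = (if p < 0 then [] else [nat p])"

text \<open>A letter \<open>z\<close> has \<open>a = z + 1\<close>: this is the number of moves from
  cell \<open>z\<close> to the blank at \<open>-1\<close> and also the number of \<open>True\<close>
  in its code. Head \<open>3\<close> counts the moves.\<close>

lemma exec_print_separator_out:
  assumes "ps 2 = int a - 1" "int a \<le> int (length x)" "- 1 \<le> ps 3" "ps 3 + int a \<le> int (length x)"
  shows "exec x (While 2 {1, 2} (Out True ;; Move 2 Go_Left ;; Move 3 Go_Right)) (ps, out)
    (ps(2 := - 1, 3 := ps 3 + int a), out @ replicate a True)"
  using assms
proof (induction a arbitrary: ps out)
  case 0
  then have eq: "(ps(2 := - 1, 3 := ps 3 + int 0), out @ replicate 0 True) = (ps, out)" by auto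
  show ?case unfolding eq by (rule exec.While_stop) (use 0 in \<open>simp add: cells_outside\<close>)
next
  case (Suc a)
  let ?p = "Out True ;; Move 2 Go_Left ;; Move 3 Go_Right"
  let ?ps = "ps(2 := ps 2 - 1, 3 := ps 3 + 1)"
  have step: "exec x ?p (ps, out) (?ps, out @ [True])"
    using Suc.prems
    by (intro exec.Seq[OF exec_Out[OF refl] exec.Seq[OF exec_Move[OF _ _ refl] exec_Move]]) auto
  have nonblank: "cells x (fst (ps, out) 2) \<in> {1, 2}"
    using Suc.prems unfolding fst_conv by (intro cells_nonblank) auto
  have "exec x (While 2 {1, 2} ?p) (?ps, out @ [True])
      (?ps(2 := - 1, 3 := ?ps 3 + int a), (out @ [True]) @ replicate a True)"
    using Suc.prems by (intro Suc.IH) auto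
  also have "(?ps(2 := - 1, 3 := ?ps 3 + int a), (out @ [True]) @ replicate a True)
      = (ps(2 := - 1, 3 := ps 3 + int (Suc a)), out @ replicate (Suc a) True)"
    by (auto simp: fun_eq_iff)
  finally show ?case by (rule exec.While_step[OF nonblank step])
qed

lemma exec_print_separator_restore:
  assumes "ps 3 = int a - 1" "int a \<le> int (length x)" "- 1 \<le> ps 2" "ps 2 + int a \<le> int (length x)"
  shows "exec x (While 3 {1, 2} (Move 3 Go_Left ;; Move 2 Go_Right)) (ps, out)
    (ps(3 := - 1, 2 := ps 2 + int a), out)"
  using assms
proof (induction a arbitrary: ps)
  case 0
  then have eq: "ps(3 := - 1, 2 := ps 2 + int 0) = ps" by auto
  show ?case unfolding eq by (rule exec.While_stop) (use 0 in \<open>simp add: cells_outside\<close>)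
next
  case (Suc a)
  let ?p = "Move 3 Go_Left ;; Move 2 Go_Right"
  let ?ps = "ps(3 := ps 3 - 1, 2 := ps 2 + 1)"
  have step: "exec x ?p (ps, out) (?ps, out)"
    using Suc.prems by (intro exec.Seq[OF exec_Move[OF _ _ refl] exec_Move]) auto
  have nonblank: "cells x (fst (ps, out) 3) \<in> {1, 2}"
    using Suc.prems unfolding fst_conv by (intro cells_nonblank) auto
  have "exec x (While 3 {1, 2} ?p) (?ps, out) (?ps(3 := - 1, 2 := ?ps 2 + int a), out)"
    using Suc.prems by (intro Suc.IH) auto
  also have "(?ps(3 := - 1, 2 := ?ps 2 + int a), out) = (ps(3 := - 1, 2 := ps 2 + int (Suc a)), out)"
    by (auto simp: fun_eq_iff)
  finally show ?case by (rule exec.While_step[OF nonblank step])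
qed

lemma exec_print_separator:
  assumes "ps 3 = - 1" "- 1 \<le> ps 2" "ps 2 < int (length x)"
  shows "exec x print_separator (ps, out) (ps, out @ letters (separator_at (ps 2)))"
proof -
  obtain a where "ps 2 + 1 = int a" using nonneg_int_cases[of "ps 2 + 1"] assms(2) by auto
  then have a: "ps 2 = int a - 1" by simp
  let ?out = "out @ letters (separator_at (ps 2))"
  let ?ps = "ps(2 := - 1, 3 := int a - 1)"
  let ?p = "While 2 {1, 2} (Out True ;; Move 2 Go_Left ;; Move 3 Go_Right) ;; Out False"
  have stop: "exec x (While 2 {1, 2} ?p) (?ps, ?out) (?ps, ?out)"
    by (rule exec.While_stop) (simp add: cells_outside)
  have 1: "exec x (While 2 {1, 2} ?p) (ps, out) (?ps, ?out)"
  proof (cases a)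
    case 0
    then have "?ps = ps" "?out = out" using assms a by (auto simp: separator_at_def)
    then show ?thesis using stop by simp
  next
    case (Suc z)
    have "(out @ replicate a True) @ [False] = ?out"
      using a Suc by (simp add: separator_at_def enc_nat_def)
    moreover have "ps 3 + int a = int a - 1" using assms by simp
    then have "exec x (While 2 {1, 2} (Out True ;; Move 2 Go_Left ;; Move 3 Go_Right)) (ps, out)
        (?ps, out @ replicate a True)"
      using exec_print_separator_out[of ps a x out] assms a by simp
    ultimately have step: "exec x ?p (ps, out) (?ps, ?out)"
      by (intro exec.Seq[OF _ exec_Out]) auto
    have nonblank: "cells x (fst (ps, out) 2) \<in> {1, 2}"
      unfolding fst_conv using assms a Suc by (intro cells_nonblank) auto
    show ?thesis by (rule exec.While_step[OF nonblank step stop])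
  qed
  have 2: "exec x (While 3 {1, 2} (Move 3 Go_Left ;; Move 2 Go_Right)) (?ps, ?out)
      (?ps(3 := - 1, 2 := ?ps 2 + int a), ?out)"
    using assms a by (intro exec_print_separator_restore) auto
  have 3: "?ps(3 := - 1, 2 := ?ps 2 + int a) = ps" using assms a by (auto simp: fun_eq_iff)
  show ?thesis using exec.Seq[OF 1 2] unfolding print_separator_def 3 .
qed

text \<open>The flag selects the side of the combined equation that is printed: \<open>False\<close>
  gives \<open>u z v\<close> and \<open>True\<close> gives \<open>v z u\<close>.\<close>

definition orient :: "bool \<Rightarrow> 'a equation \<Rightarrow> 'a equation" where
  "orient e = (if e then prod.swap else id)"

text \<open>Head \<open>0\<close> scans the equation before head \<open>1\<close> does, so that the two sides can be printed in
  either order.\<close>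

definition print_equation :: "bool \<Rightarrow> prog" where
  "print_equation e = Move 0 Go_Right ;; Move 1 Go_Right ;;
     scan_word (\<not> e) 0 ;; scan_word e 0 ;; print_separator ;; scan_word e 1 ;; scan_word (\<not> e) 1"

abbreviation enc_equation :: "nat equation \<Rightarrow> bool list" where
  "enc_equation \<equiv> enc_pair (enc_list enc_nat) (enc_list enc_nat)"

lemma exec_print_equation:
  assumes at: "occurs_at x (ps 0) (True # enc_equation uv)" and ps: "ps 1 = ps 0" "ps 3 = - 1"
    "- 1 \<le> ps 2" "ps 2 < int (length x)"
    and q: "q = ps 0 + int (length (True # enc_equation uv))"
  shows "exec x (print_equation e) (ps, out) (ps(0 := q, 1 := q),
    out @ letters (case orient e uv of (u, v) \<Rightarrow> u @ separator_at (ps 2) @ v))"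
proof -
  obtain u v where uv: "uv = (u, v)" by (cases uv)
  let ?lu = "int (length (enc_list enc_nat u))" and ?lv = "int (length (enc_list enc_nat v))"
  let ?z = "letters (separator_at (ps 2))" and ?p = "ps 0 + 1"
  have at1: "occurs_at x ?p (enc_list enc_nat u @ enc_list enc_nat v)"
    using occurs_at_ConsD(2)[OF at] by (simp add: uv enc_pair_def)
  note u = occurs_at_prefix[OF at1] and v = occurs_at_suffix[OF at1]
  note bounds = occurs_at_ConsD(3,4)[OF at]
  have q: "q = ?p + ?lu + ?lv" by (simp add: q uv enc_pair_def)
  let ?ps0 = "ps(0 := ?p)" let ?ps1 = "?ps0(1 := ?p)"
  let ?ps2 = "?ps1(0 := ?p + ?lu)" let ?ps3 = "?ps2(0 := q)"
  let ?ps4 = "?ps3(1 := ?p + ?lu)" let ?ps5 = "?ps4(1 := q)"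
  \<comment> \<open>Of the four scans exactly two print: head \<open>0\<close> prints the word
    before the separator and head \<open>1\<close> the word after it.\<close>
  let ?o2 = "out @ (if \<not> e then letters u else [])" let ?o3 = "?o2 @ (if e then letters v else [])"
  let ?o4 = "?o3 @ ?z" let ?o5 = "?o4 @ (if e then letters u else [])"
  let ?o6 = "?o5 @ (if \<not> e then letters v else [])"
  have 0: "exec x (Move 0 Go_Right) (ps, out) (?ps0, out)"
    using bounds by (intro exec_Move) auto
  have 1: "exec x (Move 1 Go_Right) (?ps0, out) (?ps1, out)"
    using bounds ps by (intro exec_Move) auto
  have 2: "exec x (scan_word (\<not> e) 0) (?ps1, out) (?ps2, ?o2)"
    using exec_scan_word[of x ?ps1 0 u "\<not> e" out] u by simp
  have 3: "exec x (scan_word e 0) (?ps2, ?o2) (?ps3, ?o3)"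
    using exec_scan_word[of x ?ps2 0 v e ?o2] v by (simp add: q)
  have 4: "exec x print_separator (?ps3, ?o3) (?ps3, ?o4)"
    using exec_print_separator[of ?ps3 x ?o3] ps by simp
  have 5: "exec x (scan_word e 1) (?ps3, ?o4) (?ps4, ?o5)"
    using exec_scan_word[of x ?ps3 1 u e ?o4] u by simp
  have 6: "exec x (scan_word (\<not> e) 1) (?ps4, ?o5) (?ps5, ?o6)"
    using exec_scan_word[of x ?ps4 1 v "\<not> e" ?o5] v by (simp add: q)
  have ps5: "?ps5 = ps(0 := q, 1 := q)" by (auto simp: fun_eq_iff)
  have o6: "?o6 = out @ letters (case orient e uv of (u, v) \<Rightarrow> u @ separator_at (ps 2) @ v)"
    by (simp add: uv orient_def)
  have "exec x (print_equation e) (ps, out) (?ps5, ?o6)"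
    unfolding print_equation_def
    by (rule exec.Seq[OF 0 exec.Seq[OF 1 exec.Seq[OF 2 exec.Seq[OF 3 exec.Seq[OF 4
          exec.Seq[OF 5 6]]]]]])
  then show ?thesis unfolding ps5 o6 .
qed

lemma enc_list_Cons: "enc_list e (y # ys) = (True # e y) @ enc_list e ys"
  by (simp add: enc_list_def)

definition print_equations :: "bool \<Rightarrow> prog" where
  "print_equations e = While 0 {2} (print_equation e)"

text \<open>Only the range of the final position \<open>q\<close> is recorded, since both heads are
  rewound before they are used again.\<close>

lemma exec_print_equations:
  assumes "occurs_at x (ps 0) (enc_list enc_equation es)" "ps 1 = ps 0" "ps 3 = - 1"
    "- 1 \<le> ps 2" "ps 2 < int (length x)"
  shows "\<exists>q. 0 \<le> q \<and> q < int (length x) \<and>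
    exec x (print_equations e) (ps, out) (ps(0 := q, 1 := q),
      out @ letters (concat (map (\<lambda>(u, v). u @ separator_at (ps 2) @ v) (map (orient e) es))))"
  using assms
proof (induction es arbitrary: ps out)
  case Nil
  then have at: "occurs_at x (ps 0) (False # [])" by (simp add: enc_list_def)
  let ?s = "(ps(0 := ps 0, 1 := ps 0),
    out @ letters (concat (map (\<lambda>(u, v). u @ separator_at (ps 2) @ v) (map (orient e) []))))"
  have eq: "?s = (ps, out)" using Nil by auto
  have "exec x (print_equations e) (ps, out) ?s"
    unfolding eq print_equations_def
    by (rule exec.While_stop) (simp add: occurs_at_ConsD(1)[OF at] bit_symbol_def)
  moreover have "0 \<le> ps 0" "ps 0 < int (length x)" using occurs_at_ConsD(3,4)[OF at] by auto
  ultimately show ?case by blast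
next
  case (Cons uv es)
  then have at: "occurs_at x (ps 0) ((True # enc_equation uv) @ enc_list enc_equation es)"
    unfolding enc_list_Cons by blast
  define q where "q = ps 0 + int (length (True # enc_equation uv))"
  let ?ps = "ps(0 := q, 1 := q)"
  let ?f = "\<lambda>(u, v). u @ separator_at (ps 2) @ v"
  let ?out = "out @ letters (?f (orient e uv))"
  have step: "exec x (print_equation e) (ps, out) (?ps, ?out)"
    using Cons.prems occurs_at_prefix[OF at] q_def by (intro exec_print_equation) auto
  have nonblank: "cells x (fst (ps, out) 0) \<in> {2}"
    using occurs_at_ConsD(1)[OF occurs_at_prefix[OF at]] by (simp add: bit_symbol_def)
  have "\<exists>q'. 0 \<le> q' \<and> q' < int (length x) \<and>
    exec x (print_equations e) (?ps, ?out) (?ps(0 := q', 1 := q'),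
      ?out @ letters (concat (map (\<lambda>(u, v). u @ separator_at (?ps 2) @ v) (map (orient e) es))))"
    using Cons.prems occurs_at_suffix[OF at] by (intro Cons.IH) (auto simp: q_def)
  then obtain q' where q': "0 \<le> q'" "q' < int (length x)" and
    rest: "exec x (print_equations e) (?ps, ?out) (?ps(0 := q', 1 := q'),
      ?out @ letters (concat (map ?f (map (orient e) es))))" by auto
  have eq: "(?ps(0 := q', 1 := q'), ?out @ letters (concat (map ?f (map (orient e) es))))
      = (ps(0 := q', 1 := q'), out @ letters (concat (map ?f (map (orient e) (uv # es)))))"
    by (auto simp: fun_eq_iff)
  have "exec x (print_equations e) (ps, out)
      (ps(0 := q', 1 := q'), out @ letters (concat (map ?f (map (orient e) (uv # es)))))"
    using exec.While_step[OF nonblank step rest[unfolded print_equations_def eq]]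
    unfolding print_equations_def .
  with q' show ?case by blast
qed

section \<open>Printing the two sides of the combined equation\<close>

definition goto_equations :: "nat \<Rightarrow> prog" where
  "goto_equations i = header False i ;; Move i Go_Right"

lemma exec_goto_equations:
  assumes x: "x = enc_nat m @ y" and i: "- 1 \<le> ps i" "ps i < int (length x)"
  shows "exec x (goto_equations i) (ps, out) (ps(i := int (length (enc_nat m))), out)"
proof -
  have "exec x (header False i) (ps, out) (ps(i := int m), out)"
    using exec_header[of x m y ps i False out, OF x i] by simp
  then show ?thesis unfolding goto_equations_def
    by (rule exec.Seq[OF _ exec_Move]) (auto simp: x enc_nat_def)
qed

definition print_block :: "bool \<Rightarrow> prog" where
  "print_block e = print_separator ;; goto_equations 0 ;; goto_equations 1 ;; print_equations e"

text \<open>The unary number at the front of the input serves as loop counter: head \<open>2\<close>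
  passes the blank at \<open>-1\<close> and the \<open>m\<close> cells holding \<open>True\<close>,
  one for each separator, and stops at the \<open>False\<close> in cell \<open>m\<close>.\<close>

definition print_side :: "bool \<Rightarrow> prog" where
  "print_side e = While 2 {0, 2} (print_block e ;; Move 2 Go_Right) ;; rewind 2"

definition eq_to_pow :: "nat \<Rightarrow> prog" where
  "eq_to_pow n = header True 2 ;; Out False ;; rewind 2 ;; print_side False ;;
     repeat_prog (n - 1) (print_side True) ;; Out False"

lemma heads_eq_to_pow: "heads (eq_to_pow n) \<subseteq> {..<4}"
  using heads_repeat_prog[of "n - 1" "print_side True"]
  by (auto simp: eq_to_pow_def print_side_def print_block_def goto_equations_def print_equations_def
      print_equation_def print_separator_def header_def rewind_def unary_def scan_word_def
      items_def field_def emit_def)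

context
  fixes x :: "bool list" and m :: nat and es :: "nat equation list"
  assumes x: "x = enc_nat m @ enc_list enc_equation es"
begin

text \<open>The invariant between blocks: head \<open>3\<close> is parked at \<open>-1\<close>, and
  heads \<open>0\<close> and \<open>1\<close> are where \<open>rewind\<close> can start.\<close>

definition heads_ok :: "(nat \<Rightarrow> int) \<Rightarrow> bool" where
  "heads_ok ps \<longleftrightarrow> ps 3 = - 1 \<and> - 1 \<le> ps 0 \<and> ps 0 < int (length x) \<and> - 1 \<le> ps 1 \<and> ps 1 < int (length x)"

lemma m_less: "int m < int (length x)"
  by (simp add: x enc_nat_def)

lemma exec_print_block:
  assumes "heads_ok ps" "- 1 \<le> ps 2" "ps 2 < int (length x)"
  shows "\<exists>q. heads_ok (ps(0 := q, 1 := q)) \<and> exec x (print_block e) (ps, out)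
    (ps(0 := q, 1 := q), out @ letters (block (map (orient e) es) (separator_at (ps 2))))"
proof -
  let ?l = "int (length (enc_nat m))"
  let ?ps0 = "ps(0 := ?l)" let ?ps1 = "?ps0(1 := ?l)"
  let ?o1 = "out @ letters (separator_at (ps 2))"
  have 1: "exec x print_separator (ps, out) (ps, ?o1)"
    using assms by (intro exec_print_separator) (auto simp: heads_ok_def)
  have 2: "exec x (goto_equations 0) (ps, ?o1) (?ps0, ?o1)"
    using assms by (intro exec_goto_equations[OF x]) (auto simp: heads_ok_def)
  have 3: "exec x (goto_equations 1) (?ps0, ?o1) (?ps1, ?o1)"
    using assms by (intro exec_goto_equations[OF x]) (auto simp: heads_ok_def)
  have "occurs_at x ?l (enc_list enc_equation es)"
    using occurs_at_suffix[of x 0 "enc_nat m"] occurs_at_self[of x] x by simp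
  then obtain q where q: "0 \<le> q" "q < int (length x)" and
    4: "exec x (print_equations e) (?ps1, ?o1) (?ps1(0 := q, 1 := q),
      ?o1 @ letters (concat (map (\<lambda>(u, v). u @ separator_at (ps 2) @ v) (map (orient e) es))))"
    using exec_print_equations[of x ?ps1 es e ?o1] assms by (auto simp: heads_ok_def)
  have "?ps1(0 := q, 1 := q) = ps(0 := q, 1 := q)" by (auto simp: fun_eq_iff)
  then have "exec x (print_block e) (ps, out)
      (ps(0 := q, 1 := q), out @ letters (block (map (orient e) es) (separator_at (ps 2))))"
    using exec.Seq[OF 1 exec.Seq[OF 2 exec.Seq[OF 3 4]]] by (simp add: print_block_def block_def)
  moreover have "heads_ok (ps(0 := q, 1 := q))" using assms q by (simp add: heads_ok_def)
  ultimately show ?thesis by blast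
qed

lemma nth_separators: "i \<le> m \<Longrightarrow> separators m ! i = separator_at (int i - 1)"
  by (cases i) (simp_all add: separators_def separator_at_def)

text \<open>The induction runs downwards from \<open>i = m + 1\<close>, where no separator is left;
  the separator of index \<open>i\<close> belongs to cell \<open>i - 1\<close>.\<close>

lemma exec_print_side_loop:
  assumes "heads_ok ps" "ps 2 = int i - 1" "i \<le> m + 1"
  shows "\<exists>ps'. heads_ok ps' \<and> ps' 2 = int m \<and>
    exec x (While 2 {0, 2} (print_block e ;; Move 2 Go_Right)) (ps, out)
      (ps', out @ letters (concat (map (block (map (orient e) es)) (drop i (separators m)))))"
  using assms(3,1,2)
proof (induction i arbitrary: ps out rule: inc_induct)
  case base
  have "cells x (int m) = bit_symbol False"
    using occurs_at_cells[of x 0 x m] occurs_at_self m_less by (simp add: x enc_nat_def nth_append)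
  then have "cells x (fst (ps, out) 2) \<notin> {0, 2}" using base by (simp add: bit_symbol_def)
  from exec.While_stop[OF this] show ?case using base
    by (intro exI[of _ ps]) (simp add: separators_def)
next
  case (step i)
  obtain q where q: "heads_ok (ps(0 := q, 1 := q))" and
    1: "exec x (print_block e) (ps, out) (ps(0 := q, 1 := q),
      out @ letters (block (map (orient e) es) (separator_at (ps 2))))"
    using exec_print_block[of ps e out] step m_less by auto
  let ?ps = "(ps(0 := q, 1 := q))(2 := ps 2 + 1)"
  let ?out = "out @ letters (block (map (orient e) es) (separator_at (ps 2)))"
  have body: "exec x (print_block e ;; Move 2 Go_Right) (ps, out) (?ps, ?out)"
    using step m_less by (intro exec.Seq[OF 1 exec_Move]) auto
  have "cells x (int i - 1) \<in> {0, 2}"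
  proof (cases i)
    case (Suc j)
    then have "cells x (int j) = bit_symbol True"
      using occurs_at_cells[of x 0 x j] occurs_at_self step m_less
      by (simp add: x enc_nat_def nth_append)
    then show ?thesis using Suc by (simp add: bit_symbol_def)
  qed (simp add: cells_outside)
  then have nonzero: "cells x (fst (ps, out) 2) \<in> {0, 2}" using step by simp
  have "heads_ok ?ps" using q by (simp add: heads_ok_def)
  moreover have "?ps 2 = int (Suc i) - 1" using step.prems by simp
  ultimately obtain ps' where ps': "heads_ok ps'" "ps' 2 = int m" and
    rest: "exec x (While 2 {0, 2} (print_block e ;; Move 2 Go_Right)) (?ps, ?out)
      (ps', ?out @ letters (concat (map (block (map (orient e) es)) (drop (Suc i) (separators m)))))"
    using step.IH[of ?ps ?out] by blast
  have "drop i (separators m) = separator_at (ps 2) # drop (Suc i) (separators m)"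
    using step nth_separators[of i] by (simp add: Cons_nth_drop_Suc[symmetric] separators_def)
  then show ?case using exec.While_step[OF nonzero body rest] ps' by (intro exI[of _ ps']) simp
qed

lemma exec_print_side:
  assumes "heads_ok ps \<and> ps 2 = - 1"
  shows "\<exists>ps'. (heads_ok ps' \<and> ps' 2 = - 1) \<and>
    exec x (print_side e) (ps, out) (ps', out @ letters (side m (map (orient e) es)))"
proof -
  obtain ps' where ps': "heads_ok ps'" "ps' 2 = int m" and
    1: "exec x (While 2 {0, 2} (print_block e ;; Move 2 Go_Right)) (ps, out)
      (ps', out @ letters (side m (map (orient e) es)))"
    using exec_print_side_loop[of ps 0 e out] assms by (auto simp: side_def)
  have "exec x (rewind 2) (ps', out @ letters (side m (map (orient e) es)))
      (ps'(2 := - 1), out @ letters (side m (map (orient e) es)))"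
    using ps' m_less by (intro exec_rewind) auto
  then show ?thesis unfolding print_side_def using exec.Seq[OF 1] ps'
    by (intro exI[of _ "ps'(2 := - 1)"]) (auto simp: heads_ok_def)
qed

lemma exec_eq_to_pow:
  "\<exists>ps. exec x (eq_to_pow n) (\<lambda>_. - 1, [])
    (ps, enc_pair enc_nat (enc_list enc_nat) (m, power_word n m es))"
proof -
  let ?ps0 = "(\<lambda>_. - 1)(2 := int m) :: nat \<Rightarrow> int"
  let ?I = "\<lambda>ps. heads_ok ps \<and> ps 2 = - 1"
  have 1: "exec x (header True 2) (\<lambda>_. - 1, []) (?ps0, replicate m True)"
    using exec_header[OF x, of "\<lambda>_. - 1" 2 True "[]"] by simp
  have 2: "exec x (Out False) (?ps0, replicate m True) (?ps0, enc_nat m)"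
    by (rule exec_Out) (simp add: enc_nat_def)
  have "?ps0(2 := - 1) = (\<lambda>_. - 1)" by auto
  then have 3: "exec x (rewind 2) (?ps0, enc_nat m) (\<lambda>_. - 1, enc_nat m)"
    using exec_rewind[of ?ps0 2 x "enc_nat m"] m_less by simp
  have "?I (\<lambda>_. - 1)" using m_less by (simp add: heads_ok_def)
  then obtain ps1 where ps1: "?I ps1" and
    4: "exec x (print_side False) (\<lambda>_. - 1, enc_nat m) (ps1, enc_nat m @ letters (side m es))"
    using exec_print_side[of "\<lambda>_. - 1" False "enc_nat m"] by (auto simp: orient_def)
  have loop: "\<exists>ps'. ?I ps' \<and> exec x (print_side True) (ps, out)
      (ps', out @ letters (side m (map prod.swap es)))" if "?I ps" for ps out
    using exec_print_side[OF that, of True out] by (simp add: orient_def)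
  obtain ps2 where
    5: "exec x (repeat_prog (n - 1) (print_side True)) (ps1, enc_nat m @ letters (side m es))
      (ps2, (enc_nat m @ letters (side m es))
        @ concat (replicate (n - 1) (letters (side m (map prod.swap es)))))"
    using exec_repeat_prog[of ?I, OF loop ps1] by blast
  have "letters (word_pow y k) = concat (replicate k (letters y))" for y k
    by (induction k) (simp_all add: word_pow_def)
  then have 6: "exec x (Out False) (ps2, (enc_nat m @ letters (side m es))
        @ concat (replicate (n - 1) (letters (side m (map prod.swap es)))))
      (ps2, enc_pair enc_nat (enc_list enc_nat) (m, power_word n m es))"
    by (intro exec_Out) (simp add: enc_pair_def enc_list_enc_nat power_word_def)
  show ?thesis unfolding eq_to_pow_def
    using exec.Seq[OF 1 exec.Seq[OF 2 exec.Seq[OF 3 exec.Seq[OF 4 exec.Seq[OF 5 6]]]]] by blast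
qed

end

theorem theorem5p4:
  fixes \<Gamma> :: "'c set" and n :: nat
  assumes "alphabet \<Gamma>" and "n \<ge> 2"
  shows "Pow_problem \<Gamma> n \<le>\<^sub>p EqSatCF \<Gamma> \<and> EqSatCF \<Gamma> \<le>\<^sub>p Pow_problem \<Gamma> n"
proof
  define f where "f = (\<lambda>(m, w). (m + 1, [(w, replicate n m)]) :: nat \<times> nat equation list)"
  have "poly_time_computable (instances (Pow_problem \<Gamma> n)) (encode (Pow_problem \<Gamma> n))
      (encode (EqSatCF \<Gamma>)) f"
  proof (rule exec_poly_time[OF heads_pow_to_eq])
    fix i :: "nat \<times> nat list"
    show "\<exists>ps. exec (encode (Pow_problem \<Gamma> n) i) (pow_to_eq n) (\<lambda>_. - 1, [])
        (ps, encode (EqSatCF \<Gamma>) (f i))"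
      using exec_pow_to_eq[OF refl, of "fst i" "snd i" n]
      by (cases i) (simp add: Pow_problem_def EqSatCF_def f_def enc_pair_def)
  qed
  moreover have "f i \<in> instances (EqSatCF \<Gamma>) \<and>
      (i \<in> yes (Pow_problem \<Gamma> n) \<longleftrightarrow> f i \<in> yes (EqSatCF \<Gamma>))"
    if inst: "i \<in> instances (Pow_problem \<Gamma> n)" for i
  proof -
    obtain m w where i: "i = (m, w)" by (cases i)
    have m: "2 \<le> m" and w: "w \<in> lists {..<m}" "w \<noteq> []"
      using inst by (auto simp: i Pow_problem_def alphabet_def)
    have "w \<in> lists {..<m + 1}" using w(1) by auto
    moreover have "replicate n m \<in> lists {..<m + 1}" by auto
    ultimately have "f i \<in> instances (EqSatCF \<Gamma>)"
      using m by (simp add: i f_def EqSatCF_def alphabet_def)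
    moreover have "insert m {..<m} = {..<m + 1}" by auto
    then have "i \<in> yes (Pow_problem \<Gamma> n) \<longleftrightarrow> f i \<in> yes (EqSatCF \<Gamma>)"
      using power_iff_equation[OF assms(1) _ _ w, of n m] assms(2)
      by (simp add: i f_def Pow_problem_def EqSatCF_def)
    ultimately show ?thesis ..
  qed
  ultimately show "Pow_problem \<Gamma> n \<le>\<^sub>p EqSatCF \<Gamma>" unfolding poly_reducible_def by blast
next
  define f where "f = (\<lambda>(m, es). (m, power_word n m es))"
  have "poly_time_computable (instances (EqSatCF \<Gamma>)) (encode (EqSatCF \<Gamma>))
      (encode (Pow_problem \<Gamma> n)) f"
  proof (rule exec_poly_time[OF heads_eq_to_pow])
    fix i :: "nat \<times> nat equation list"
    show "\<exists>ps. exec (encode (EqSatCF \<Gamma>) i) (eq_to_pow n) (\<lambda>_. - 1, [])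
        (ps, encode (Pow_problem \<Gamma> n) (f i))"
      using exec_eq_to_pow[OF refl, of "fst i" "snd i" n]
      by (cases i) (simp add: Pow_problem_def EqSatCF_def f_def enc_pair_def)
  qed
  moreover have "f i \<in> instances (Pow_problem \<Gamma> n) \<and>
      (i \<in> yes (EqSatCF \<Gamma>) \<longleftrightarrow> f i \<in> yes (Pow_problem \<Gamma> n))"
    if inst: "i \<in> instances (EqSatCF \<Gamma>)" for i
  proof -
    obtain m es where i: "i = (m, es)" by (cases i)
    have m: "alphabet {..<m}" "2 \<le> m" and es: "set es \<subseteq> lists {..<m} \<times> lists {..<m}"
      using inst by (auto simp: i EqSatCF_def alphabet_def)
    \<comment> \<open>This makes \<open>power_word n m es\<close> nonempty, as instances of
      \<open>Pow_problem\<close> require, even for an empty system.\<close>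
    have "0 \<in> set (side m es)" using m(2) by (auto simp: side_def block_def separators_def)
    moreover have "power_word n m es \<in> lists {..<m}"
      using side_in_lists[OF es] side_in_lists[OF swap_in_lists[OF es]]
      by (auto simp: power_word_def word_pow_def)
    ultimately have "f i \<in> instances (Pow_problem \<Gamma> n)"
      using m(1) by (auto simp: i f_def Pow_problem_def power_word_def)
    moreover have "i \<in> yes (EqSatCF \<Gamma>) \<longleftrightarrow> f i \<in> yes (Pow_problem \<Gamma> n)"
      using equations_iff_power[OF es assms(2), of \<Gamma>]
      by (simp add: i f_def Pow_problem_def EqSatCF_def)
    ultimately show ?thesis ..
  qed
  ultimately show "EqSatCF \<Gamma> \<le>\<^sub>p Pow_problem \<Gamma> n" unfolding poly_reducible_def by blast
qed

end
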